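(* Let $d\ge1$ be an integer, let $\nu>0$, and choose $\rho=\sqrt{2\nu}$. Then the Matérn covariance operator $\Gamma_{\nu,\sqrt{2\nu}}$ on $L^2(\mathbb{R}^d)$ coincides, up to a constant multiplier, with the adjoint Sobolev embedding operator $E_{\nu+d/2}^*$: there is a nonzero constant $c$ (not depending on $u$) such that $$\Gamma_{\nu,\sqrt{2\nu}}\,u = c\,E_{\nu+d/2}^*\,u\qquad\text{for all }u\in L^2(\mathbb{R}^d).$$
   Context: For $\nu,\rho>0$, the Matérn covariance function on $\mathbb{R}^d$ is $$k_{\nu,\rho}(x)=\frac{2^{1-\nu}}{\mathbf{G}(\nu)}\left(\frac{\sqrt{2\nu}\,|x|}{\rho}\right)^{\nu}K_\nu\!\left(\frac{\sqrt{2\nu}\,|x|}{\rho}\right),$$ where $\mathbf{G}$ is the gamma function and $K_\nu$ is the Macdonald function (modified Bessel function of the second kind) of order $\nu$. The Matérn covariance operator is the convolution operator $\Gamma_{\nu,\rho}u=k_{\nu,\rho}\ast u$. The Fourier transform is $\mathcal{F}u(\xi)=\int_{\mathbb{R}^d}e^{-\mathrm{i}2\pi\langle\xi,x\rangle}u(x)\,dx$ (extended to $L^2(\mathbb{R}^d)$ as usual). For $s>0$, $H^s(\mathbb{R}^d)$ is the $L^2$-based Sobolev space of functions $u$ such that $\mathcal{F}^{-1}\big((1+4\pi^2|\cdot|^2)^{r/2}\mathcal{F}u\big)\in L^2(\mathbb{R}^d)$ for all $0\le r\le s$, with the inner product $$\langle u,v\rangle_{H^s}=\int_{\mathbb{R}^d}(1+4\pi^2|\xi|^2)^{s}\,\mathcal{F}u(\xi)\,\overline{\mathcal{F}v(\xi)}\,d\xi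 .$$ $E_s:H^s(\mathbb{R}^d)\to L^2(\mathbb{R}^d)$, $E_sx=x$, is the Sobolev embedding operator, and $E_s^*:L^2(\mathbb{R}^d)\to H^s(\mathbb{R}^d)$ is its Hilbert-space adjoint, i.e. $\langle E_sx,u\rangle_{L^2}=\langle x,E_s^*u\rangle_{H^s}$ for all $x\in H^s(\mathbb{R}^d)$, $u\in L^2(\mathbb{R}^d)$. *)

theory Defs
  imports "HOL-Analysis.Analysis"
begin

section \<open>The Matern covariance operator\<close>

text \<open>
  The Macdonald function (modified Bessel function of the second kind) of real order and
  positive argument, defined by its classical integral
  \<open>K\<^sub>\<nu>(z) = \<integral>\<^sub>0\<^sup>\<infinity> exp (- z cosh t) cosh (\<nu> t) dt\<close> for \<open>z > 0\<close>.
\<close>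

definition macdonald :: "real \<Rightarrow> real \<Rightarrow> real" where
  "macdonald \<nu> z = (LINT t:{0..}|lborel. exp (- z * cosh t) * cosh (\<nu> * t))"

text \<open>
  The formula for the covariance function is of the form ``zero times infinity'' at the
  origin; as usual, the value there is the continuous extension, which is 1.
\<close>

definition matern :: "real \<Rightarrow> real \<Rightarrow> 'a::euclidean_space \<Rightarrow> real" where
  "matern \<nu> \<rho> x =
    (if x = 0 then 1
     else 2 powr (1 - \<nu>) / Gamma \<nu> * (sqrt (2 * \<nu>) * norm x / \<rho>) powr \<nu>
            * macdonald \<nu> (sqrt (2 * \<nu>) * norm x / \<rho>))"

definition convolution :: "('a::euclidean_space \<Rightarrow> complex) \<Rightarrow> ('a \<Rightarrow> complex) \<Rightarrow> 'a \<Rightarrow> complex" where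
  "convolution k u x = (LINT y|lborel. k (x - y) * u y)"

definition matern_operator ::
    "real \<Rightarrow> real \<Rightarrow> ('a::euclidean_space \<Rightarrow> complex) \<Rightarrow> 'a \<Rightarrow> complex" where
  "matern_operator \<nu> \<rho> u = convolution (\<lambda>x. complex_of_real (matern \<nu> \<rho> x)) u"


section \<open>Square integrable functions and the Fourier transform\<close>

text \<open>
  Elements of \<open>L\<^sup>2\<close> are represented by Borel measurable functions; all notions below respect
  equality almost everywhere, which is the equality of \<open>L\<^sup>2\<close>.
\<close>

definition L1_space :: "('a::euclidean_space \<Rightarrow> complex) set" where
  "L1_space = {u. integrable lborel u}"

definition L2_space :: "('a::euclidean_space \<Rightarrow> complex) set" where
  "L2_space = {u \<in> borel_measurable lborel. integrable lborel (\<lambda>x. (cmod (u x))\<^sup>2)}"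

definition L2_inner :: "('a::euclidean_space \<Rightarrow> complex) \<Rightarrow> ('a \<Rightarrow> complex) \<Rightarrow> complex" where
  "L2_inner u v = (LINT x|lborel. u x * cnj (v x))"

definition L2_tendsto ::
    "(nat \<Rightarrow> 'a::euclidean_space \<Rightarrow> complex) \<Rightarrow> ('a \<Rightarrow> complex) \<Rightarrow> bool" where
  "L2_tendsto f u \<longleftrightarrow> (\<forall>n. f n \<in> L2_space) \<and> u \<in> L2_space \<and>
     (\<lambda>n. LINT x|lborel. (cmod (f n x - u x))\<^sup>2) \<longlonglongrightarrow> 0"

definition fourier_L1 :: "('a::euclidean_space \<Rightarrow> complex) \<Rightarrow> 'a \<Rightarrow> complex" where
  "fourier_L1 u \<xi> = (LINT x|lborel. exp (- (\<i> * 2 * pi * (\<xi> \<bullet> x))) * u x)"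

text \<open>
  Extension of the Fourier integral by continuity from \<open>L\<^sup>1 \<inter> L\<^sup>2\<close> to \<open>L\<^sup>2\<close>, first as a relation
  (\<open>v\<close> is the transform of \<open>u\<close>), then as a function that picks one representative of the
  almost-everywhere class of transforms.
\<close>

definition has_fourier :: "('a::euclidean_space \<Rightarrow> complex) \<Rightarrow> ('a \<Rightarrow> complex) \<Rightarrow> bool" where
  "has_fourier u v \<longleftrightarrow>
     (\<exists>f. (\<forall>n. f n \<in> L1_space) \<and> L2_tendsto f u \<and> L2_tendsto (\<lambda>n. fourier_L1 (f n)) v)"

definition fourier :: "('a::euclidean_space \<Rightarrow> complex) \<Rightarrow> 'a \<Rightarrow> complex" where
  "fourier u = (SOME v. has_fourier u v)"


section \<open>Sobolev spaces and the adjoint of the Sobolev embedding\<close>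

text \<open>
  That the inverse Fourier transform of \<open>g\<close> belongs to \<open>L\<^sup>2\<close> means that \<open>g\<close> is the transform
  of some \<open>w\<close> in \<open>L\<^sup>2\<close>.
\<close>

definition inverse_fourier_in_L2 :: "('a::euclidean_space \<Rightarrow> complex) \<Rightarrow> bool" where
  "inverse_fourier_in_L2 g \<longleftrightarrow> (\<exists>w \<in> L2_space. has_fourier w g)"

definition sobolev_space :: "real \<Rightarrow> ('a::euclidean_space \<Rightarrow> complex) set" where
  "sobolev_space s =
    {u \<in> L2_space. \<forall>r. 0 \<le> r \<and> r \<le> s \<longrightarrow>
       inverse_fourier_in_L2
         (\<lambda>\<xi>. complex_of_real ((1 + 4 * pi\<^sup>2 * (norm \<xi>)\<^sup>2) powr (r / 2)) * fourier u \<xi>)}"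

definition sobolev_inner ::
    "real \<Rightarrow> ('a::euclidean_space \<Rightarrow> complex) \<Rightarrow> ('a \<Rightarrow> complex) \<Rightarrow> complex" where
  "sobolev_inner s u v =
    (LINT \<xi>|lborel. complex_of_real ((1 + 4 * pi\<^sup>2 * (norm \<xi>)\<^sup>2) powr s)
                      * fourier u \<xi> * cnj (fourier v \<xi>))"

definition sobolev_embedding ::
    "real \<Rightarrow> ('a::euclidean_space \<Rightarrow> complex) \<Rightarrow> 'a \<Rightarrow> complex" where
  "sobolev_embedding s u = u"

definition is_adjoint ::
    "'x set \<Rightarrow> ('x \<Rightarrow> 'x \<Rightarrow> complex) \<Rightarrow> 'y set \<Rightarrow> ('y \<Rightarrow> 'y \<Rightarrow> complex)
      \<Rightarrow> ('x \<Rightarrow> 'y) \<Rightarrow> ('y \<Rightarrow> 'x) \<Rightarrow> bool" where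
  "is_adjoint X ipX Y ipY T S \<longleftrightarrow>
     (\<forall>u\<in>Y. S u \<in> X) \<and> (\<forall>x\<in>X. \<forall>u\<in>Y. ipY (T x) u = ipX x (S u))"

text \<open>
  The values of the adjoint on \<open>L\<^sup>2\<close> are determined up to equality almost everywhere; the
  choice operator only selects representatives.
\<close>

definition sobolev_embedding_adjoint ::
    "real \<Rightarrow> ('a::euclidean_space \<Rightarrow> complex) \<Rightarrow> 'a \<Rightarrow> complex" where
  "sobolev_embedding_adjoint s =
    (SOME S. is_adjoint (sobolev_space s) (sobolev_inner s) L2_space L2_inner
               (sobolev_embedding s) S)"

end

theory Submission
  imports Defs "HOL-Probability.Characteristic_Functions"
begin

text \<open>
  On the Fourier side both operators are multiplications by the same function, up to a constant.
  Write \<open>w(\<xi>) = 1 + 4 \<pi>\<^sup>2 |\<xi>|\<^sup>2\<close>, \<open>d\<close> for the dimension and \<open>s = \<nu> + d / 2\<close>.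

  If \<open>v\<close> is the image of \<open>u\<close> under the adjoint embedding, then
  \<open>\<integral> F x \<sqdot> cnj (F u) = \<integral> w\<^sup>s \<sqdot> F x \<sqdot> cnj (F v)\<close> for all \<open>x\<close> in the Sobolev space, by Parseval's
  identity. This forces \<open>F v = w powr (-s) \<sqdot> F u\<close>, and the function with this transform does lie in
  the Sobolev space because \<open>w \<ge> 1\<close> (\<open>sobolev_adjoint_by_multiplier\<close>,
  \<open>sobolev_adjoint_unique\<close>).

  The Matern kernel is a Gamma mixture of Gaussians: the substitution \<open>t = (z / 2) exp \<tau>\<close> in the
  integral that defines the Macdonald function gives
  \<open>k(x) = 1 / \<Gamma>(\<nu>) \<integral>\<^sub>0\<^sup>\<infinity> t powr (\<nu> - 1) exp (-t) exp (- |x|\<^sup>2 / (4 t)) dt\<close>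
  (\<open>matern_gauss_mixture\<close>). Transforming the Gaussians under the integral turns this into
  a Gamma integral again, \<open>F k = (4 \<pi>) powr (d / 2) \<Gamma>(s) / \<Gamma>(\<nu>) \<sqdot> w powr (-s)\<close>
  (\<open>fourier_matern\<close>). The mixture also shows that \<open>k\<close> is nonnegative, integrable
  and bounded by 1, so convolution with \<open>k\<close> acts on \<open>L\<^sup>2\<close> and multiplies transforms by \<open>F k\<close>
  (\<open>has_fourier_conv\<close>). The constant is therefore
  \<open>c = (4 \<pi>) powr (d / 2) \<Gamma>(s) / \<Gamma>(\<nu>)\<close>.

  This argument needs the transform on \<open>L\<^sup>2\<close> to be a well-defined unitary operator. Its
  ingredients are built from one device, convolution with the heat kernel \<open>K\<^sub>\<delta>\<close>, which is the
  transform of a Gaussian. For \<open>f \<in> L\<^sup>1\<close>, Fubini gives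
  \<open>\<integral> |F f|\<^sup>2 exp (- \<pi> \<delta>\<^sup>2 |\<xi>|\<^sup>2) d\<xi> = \<langle>K\<^sub>\<delta> * f, f\<rangle>\<close>, and the heat kernels are an approximate identity in
  \<open>L\<^sup>2\<close> (\<open>heat_tendsto_L2\<close>); letting \<open>\<delta>\<close> tend to 0 yields the isometry
  (\<open>plancherel_L1_L2\<close>). Existence of transforms then follows from completeness of \<open>L\<^sup>2\<close>, and
  surjectivity from the fact that \<open>K\<^sub>\<delta> * g\<close> is itself a transform when \<open>g\<close> is integrable.
\<close>

section \<open>Norm and inner product of square integrable functions\<close>

definition L2_norm :: "('a::euclidean_space \<Rightarrow> complex) \<Rightarrow> real" where
  "L2_norm u = sqrt (LINT x|lborel. (cmod (u x))\<^sup>2)"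

lemma L2_spaceI:
  "u \<in> borel_measurable borel \<Longrightarrow> integrable lborel (\<lambda>x. (cmod (u x))\<^sup>2) \<Longrightarrow> u \<in> L2_space"
  by (simp add: L2_space_def)

lemma L2_space_measurable [measurable_dest]: "u \<in> L2_space \<Longrightarrow> u \<in> borel_measurable borel"
  by (simp add: L2_space_def)

lemma L2_space_integrable: "u \<in> L2_space \<Longrightarrow> integrable lborel (\<lambda>x. (cmod (u x))\<^sup>2)"
  by (simp add: L2_space_def)

lemma L2_norm_nonneg [simp]: "0 \<le> L2_norm u"
  by (simp add: L2_norm_def)

lemma L2_norm_square: "(L2_norm u)\<^sup>2 = (LINT x|lborel. (cmod (u x))\<^sup>2)"
  by (simp add: L2_norm_def)

lemma L2_space_dominated:
  assumes v: "v \<in> L2_space" and [measurable]: "u \<in> borel_measurable borel"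
    and le: "AE x in lborel. cmod (u x) \<le> C * cmod (v x)"
  shows "u \<in> L2_space"
proof (rule L2_spaceI)
  show "integrable lborel (\<lambda>x. (cmod (u x))\<^sup>2)"
  proof (rule Bochner_Integration.integrable_bound)
    show "integrable lborel (\<lambda>x. C\<^sup>2 * (cmod (v x))\<^sup>2)"
      using L2_space_integrable[OF v] by simp
    show "AE x in lborel. norm ((cmod (u x))\<^sup>2) \<le> norm (C\<^sup>2 * (cmod (v x))\<^sup>2)"
      using le
    proof eventually_elim
      case (elim x)
      then have "(cmod (u x))\<^sup>2 \<le> (C * cmod (v x))\<^sup>2" by (intro power_mono) auto
      then show ?case by (simp add: power_mult_distrib)
    qed
  qed simp
qed simp

lemma L2_norm_mono_AE:
  assumes u: "u \<in> L2_space" and v: "v \<in> L2_space"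
    and le: "AE x in lborel. cmod (u x) \<le> cmod (v x)"
  shows "L2_norm u \<le> L2_norm v"
  unfolding L2_norm_def
  by (intro real_sqrt_le_mono integral_mono_AE L2_space_integrable u v)
     (use le in eventually_elim, auto intro: power_mono)

lemma L2_norm_cong_AE:
  assumes [measurable]: "u \<in> borel_measurable borel" "v \<in> borel_measurable borel"
    and "AE x in lborel. u x = v x"
  shows "L2_norm u = L2_norm v"
  unfolding L2_norm_def
  by (intro arg_cong[where f=sqrt] integral_cong_AE) (use assms(3) in auto)

lemma L2_norm_minus_commute: "L2_norm (\<lambda>x. u x - v x) = L2_norm (\<lambda>x. v x - u x)"
  by (simp add: L2_norm_def norm_minus_commute)

lemma borel_measurable_cnj [measurable]: "cnj \<in> borel_measurable borel"
  by (intro borel_measurable_continuous_onI continuous_intros)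

lemma L2_product_integrable:
  assumes u: "u \<in> L2_space" and v: "v \<in> L2_space"
  shows "integrable lborel (\<lambda>x. cmod (u x) * cmod (v x))"
proof (rule Bochner_Integration.integrable_bound)
  note [measurable] = L2_space_measurable[OF u] L2_space_measurable[OF v]
  show "integrable lborel (\<lambda>x. (cmod (u x))\<^sup>2 + (cmod (v x))\<^sup>2)"
    using L2_space_integrable[OF u] L2_space_integrable[OF v] by simp
  have "a * b \<le> a\<^sup>2 + b\<^sup>2" if "0 \<le> a" "0 \<le> b" for a b :: real
    using sum_squares_bound[of a b] mult_nonneg_nonneg[OF that] by linarith
  then show "AE x in lborel. norm (cmod (u x) * cmod (v x)) \<le> norm ((cmod (u x))\<^sup>2 + (cmod (v x))\<^sup>2)"
    by auto
  show "(\<lambda>x. cmod (u x) * cmod (v x)) \<in> borel_measurable lborel" by simp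
qed

lemma L2_inner_integrable:
  assumes u: "u \<in> L2_space" and v: "v \<in> L2_space"
  shows "integrable lborel (\<lambda>x. u x * cnj (v x))"
proof (rule Bochner_Integration.integrable_bound[OF L2_product_integrable[OF u v]])
  note [measurable] = L2_space_measurable[OF u] L2_space_measurable[OF v]
  show "(\<lambda>x. u x * cnj (v x)) \<in> borel_measurable lborel" by simp
qed (simp add: norm_mult)

lemma L2_Cauchy_Schwarz_cmod:
  assumes u: "u \<in> L2_space" and v: "v \<in> L2_space"
  shows "(LINT x|lborel. cmod (u x) * cmod (v x)) \<le> L2_norm u * L2_norm v"
proof -
  note [measurable] = L2_space_measurable[OF u] L2_space_measurable[OF v]
  let ?C = "LINT x|lborel. cmod (u x) * cmod (v x)"
  have C: "0 \<le> ?C" by (intro integral_nonneg_AE) auto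
  have "(\<integral>\<^sup>+x. ennreal (cmod (u x)) * ennreal (cmod (v x)) \<partial>lborel)\<^sup>2
     \<le> (\<integral>\<^sup>+x. (ennreal (cmod (u x)))\<^sup>2 \<partial>lborel) * (\<integral>\<^sup>+x. (ennreal (cmod (v x)))\<^sup>2 \<partial>lborel)"
    by (rule Cauchy_Schwarz_nn_integral) auto
  also have "(\<integral>\<^sup>+x. ennreal (cmod (u x)) * ennreal (cmod (v x)) \<partial>lborel) = ennreal ?C"
    using nn_integral_eq_integral[OF L2_product_integrable[OF u v]]
    by (simp add: ennreal_mult)
  also have "(\<integral>\<^sup>+x. (ennreal (cmod (u x)))\<^sup>2 \<partial>lborel) = ennreal ((L2_norm u)\<^sup>2)"
    using nn_integral_eq_integral[OF L2_space_integrable[OF u]]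
    by (simp add: ennreal_power L2_norm_square)
  also have "(\<integral>\<^sup>+x. (ennreal (cmod (v x)))\<^sup>2 \<partial>lborel) = ennreal ((L2_norm v)\<^sup>2)"
    using nn_integral_eq_integral[OF L2_space_integrable[OF v]]
    by (simp add: ennreal_power L2_norm_square)
  finally have "?C\<^sup>2 \<le> (L2_norm u * L2_norm v)\<^sup>2"
    using C by (simp add: ennreal_power flip: ennreal_mult' power_mult_distrib)
  then show ?thesis by (rule power2_le_imp_le) simp
qed

lemma L2_Cauchy_Schwarz:
  assumes u: "u \<in> L2_space" and v: "v \<in> L2_space"
  shows "cmod (L2_inner u v) \<le> L2_norm u * L2_norm v"
proof -
  have "cmod (L2_inner u v) \<le> (LINT x|lborel. cmod (u x * cnj (v x)))"
    unfolding L2_inner_def by (rule integral_norm_bound)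
  also have "\<dots> \<le> L2_norm u * L2_norm v"
    using L2_Cauchy_Schwarz_cmod[OF u v] by (simp add: norm_mult)
  finally show ?thesis .
qed

lemma L2_space_add:
  assumes u: "u \<in> L2_space" and v: "v \<in> L2_space"
  shows "(\<lambda>x. u x + v x) \<in> L2_space"
proof (rule L2_spaceI)
  note [measurable] = L2_space_measurable[OF u] L2_space_measurable[OF v]
  show "(\<lambda>x. u x + v x) \<in> borel_measurable borel" by simp
  show "integrable lborel (\<lambda>x. (cmod (u x + v x))\<^sup>2)"
  proof (rule Bochner_Integration.integrable_bound)
    show "integrable lborel (\<lambda>x. (cmod (u x))\<^sup>2 + 2 * (cmod (u x) * cmod (v x)) + (cmod (v x))\<^sup>2)"
      using L2_space_integrable[OF u] L2_space_integrable[OF v] L2_product_integrable[OF u v] by simp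
    show "AE x in lborel. norm ((cmod (u x + v x))\<^sup>2)
        \<le> norm ((cmod (u x))\<^sup>2 + 2 * (cmod (u x) * cmod (v x)) + (cmod (v x))\<^sup>2)"
    proof (rule AE_I2)
      fix x
      have "(cmod (u x + v x))\<^sup>2 \<le> (cmod (u x) + cmod (v x))\<^sup>2"
        by (intro power_mono norm_triangle_ineq) auto
      then show "norm ((cmod (u x + v x))\<^sup>2)
        \<le> norm ((cmod (u x))\<^sup>2 + 2 * (cmod (u x) * cmod (v x)) + (cmod (v x))\<^sup>2)"
        by (simp add: power2_sum algebra_simps)
    qed
  qed simp
qed

lemma L2_space_cmult: "u \<in> L2_space \<Longrightarrow> (\<lambda>x. c * u x) \<in> L2_space"
  by (rule L2_space_dominated[where v=u and C="cmod c"]) (auto simp: norm_mult)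

lemma L2_norm_cmult: "L2_norm (\<lambda>x. c * u x) = cmod c * L2_norm u"
  by (simp add: L2_norm_def norm_mult power_mult_distrib real_sqrt_mult)

lemma L2_space_diff:
  "u \<in> L2_space \<Longrightarrow> v \<in> L2_space \<Longrightarrow> (\<lambda>x. u x - v x) \<in> L2_space"
  using L2_space_add[of u "\<lambda>x. - 1 * v x"] L2_space_cmult[of v "-1"] by simp

lemma L2_norm_triangle:
  assumes u: "u \<in> L2_space" and v: "v \<in> L2_space"
  shows "L2_norm (\<lambda>x. u x + v x) \<le> L2_norm u + L2_norm v"
proof (rule power2_le_imp_le)
  note [simp] = L2_space_integrable[OF u] L2_space_integrable[OF v] L2_product_integrable[OF u v]
  have "(L2_norm (\<lambda>x. u x + v x))\<^sup>2
      \<le> (LINT x|lborel. (cmod (u x))\<^sup>2 + 2 * (cmod (u x) * cmod (v x)) + (cmod (v x))\<^sup>2)"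
    unfolding L2_norm_square
  proof (rule integral_mono)
    show "integrable lborel (\<lambda>x. (cmod (u x + v x))\<^sup>2)"
      by (rule L2_space_integrable[OF L2_space_add[OF u v]])
    fix x
    have "(cmod (u x + v x))\<^sup>2 \<le> (cmod (u x) + cmod (v x))\<^sup>2"
      by (intro power_mono norm_triangle_ineq) auto
    then show "(cmod (u x + v x))\<^sup>2 \<le> (cmod (u x))\<^sup>2 + 2 * (cmod (u x) * cmod (v x)) + (cmod (v x))\<^sup>2"
      by (simp add: power2_sum algebra_simps)
  qed simp
  also have "\<dots> = (L2_norm u)\<^sup>2 + 2 * (LINT x|lborel. cmod (u x) * cmod (v x)) + (L2_norm v)\<^sup>2"
    by (simp add: L2_norm_square)
  also have "\<dots> \<le> (L2_norm u + L2_norm v)\<^sup>2"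
    using L2_Cauchy_Schwarz_cmod[OF u v] by (simp add: power2_sum)
  finally show "(L2_norm (\<lambda>x. u x + v x))\<^sup>2 \<le> (L2_norm u + L2_norm v)\<^sup>2" .
qed simp

lemma L2_norm_triangle_diff:
  assumes u: "u \<in> L2_space" and v: "v \<in> L2_space" and w: "w \<in> L2_space"
  shows "L2_norm (\<lambda>x. u x - w x) \<le> L2_norm (\<lambda>x. u x - v x) + L2_norm (\<lambda>x. v x - w x)"
  using L2_norm_triangle[OF L2_space_diff[OF u v] L2_space_diff[OF v w]] by simp

lemma L2_norm_reverse_triangle:
  assumes u: "u \<in> L2_space" and v: "v \<in> L2_space"
  shows "\<bar>L2_norm u - L2_norm v\<bar> \<le> L2_norm (\<lambda>x. u x - v x)"
  using L2_norm_triangle[OF L2_space_diff[OF u v] v] L2_norm_triangle[OF L2_space_diff[OF v u] u]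
  by (simp add: L2_norm_minus_commute[of u v])

lemma L2_norm_eq_0_imp_AE:
  assumes u: "u \<in> L2_space" and 0: "L2_norm u = 0"
  shows "AE x in lborel. u x = 0"
proof -
  have "(LINT x|lborel. (cmod (u x))\<^sup>2) = 0"
    using 0 by (simp flip: L2_norm_square)
  then have "AE x in lborel. (cmod (u x))\<^sup>2 = 0"
    by (subst (asm) integral_nonneg_eq_0_iff_AE) (use L2_space_integrable[OF u] in auto)
  then show ?thesis by simp
qed

lemma L2_inner_self: "L2_inner u u = complex_of_real ((L2_norm u)\<^sup>2)"
  unfolding L2_inner_def L2_norm_square integral_complex_of_real[symmetric]
  by (simp add: complex_norm_square flip: of_real_power)

lemma L2_norm_square_add:
  assumes u: "u \<in> L2_space" and v: "v \<in> L2_space"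
  shows "(L2_norm (\<lambda>x. u x + v x))\<^sup>2 = (L2_norm u)\<^sup>2 + 2 * Re (L2_inner u v) + (L2_norm v)\<^sup>2"
proof -
  note [simp] = L2_space_integrable[OF u] L2_space_integrable[OF v] L2_inner_integrable[OF u v]
  have "Re (L2_inner u v) = (LINT x|lborel. Re (u x * cnj (v x)))"
    unfolding L2_inner_def by (rule integral_Re[symmetric]) simp
  then have "(L2_norm u)\<^sup>2 + 2 * Re (L2_inner u v) + (L2_norm v)\<^sup>2
     = (LINT x|lborel. (cmod (u x))\<^sup>2 + 2 * Re (u x * cnj (v x)) + (cmod (v x))\<^sup>2)"
    using integrable_Re[OF L2_inner_integrable[OF u v]]
    unfolding L2_norm_square by (simp del: times_complex.simps)
  also have "\<dots> = (LINT x|lborel. (cmod (u x + v x))\<^sup>2)"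
    by (intro Bochner_Integration.integral_cong refl)
       (simp add: cmod_power2, simp add: power2_eq_square algebra_simps)
  finally show ?thesis by (simp add: L2_norm_square)
qed

lemma L2_norm_square_diff:
  assumes u: "u \<in> L2_space" and v: "v \<in> L2_space"
  shows "(L2_norm (\<lambda>x. u x - v x))\<^sup>2 = (L2_norm u)\<^sup>2 - 2 * Re (L2_inner u v) + (L2_norm v)\<^sup>2"
  using L2_norm_square_add[OF u L2_space_cmult[OF v, of "-1"]] L2_norm_cmult[of "-1" v]
  by (simp add: L2_inner_def)

section \<open>Limits and dense subspaces\<close>

lemma L2_tendsto_iff:
  "L2_tendsto f u \<longleftrightarrow> (\<forall>n. f n \<in> L2_space) \<and> u \<in> L2_space \<and> (\<lambda>n. L2_norm (\<lambda>x. f n x - u x)) \<longlonglongrightarrow> 0"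
proof -
  have "(\<lambda>n. LINT x|lborel. (cmod (f n x - u x))\<^sup>2) \<longlonglongrightarrow> 0 \<longleftrightarrow> (\<lambda>n. L2_norm (\<lambda>x. f n x - u x)) \<longlonglongrightarrow> 0"
  proof
    assume "(\<lambda>n. LINT x|lborel. (cmod (f n x - u x))\<^sup>2) \<longlonglongrightarrow> 0"
    from tendsto_real_sqrt[OF this] show "(\<lambda>n. L2_norm (\<lambda>x. f n x - u x)) \<longlonglongrightarrow> 0"
      by (simp add: L2_norm_def)
  next
    assume "(\<lambda>n. L2_norm (\<lambda>x. f n x - u x)) \<longlonglongrightarrow> 0"
    from tendsto_power[OF this, of 2] show "(\<lambda>n. LINT x|lborel. (cmod (f n x - u x))\<^sup>2) \<longlonglongrightarrow> 0"
      by (simp add: L2_norm_square)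
  qed
  then show ?thesis by (auto simp: L2_tendsto_def)
qed

lemma L2_tendsto_norm:
  assumes "L2_tendsto f u"
  shows "(\<lambda>n. L2_norm (f n)) \<longlonglongrightarrow> L2_norm u"
proof (rule Lim_transform2[OF tendsto_const])
  have "(\<lambda>n. L2_norm (\<lambda>x. f n x - u x)) \<longlonglongrightarrow> 0" using assms by (simp add: L2_tendsto_iff)
  then show "(\<lambda>n. L2_norm u - L2_norm (f n)) \<longlonglongrightarrow> 0"
    by (rule Lim_null_comparison[rotated])
       (use assms in \<open>auto simp: L2_tendsto_iff L2_norm_minus_commute[of _ u]
          intro!: always_eventually L2_norm_reverse_triangle\<close>)
qed

lemma L2_tendsto_diff:
  assumes f: "L2_tendsto f u" and g: "L2_tendsto g v"
  shows "L2_tendsto (\<lambda>n x. f n x - g n x) (\<lambda>x. u x - v x)"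
  unfolding L2_tendsto_iff
proof (intro conjI allI)
  have F: "\<And>n. f n \<in> L2_space" "u \<in> L2_space" "\<And>n. g n \<in> L2_space" "v \<in> L2_space"
    using f g by (auto simp: L2_tendsto_iff)
  then show "(\<lambda>x. f n x - g n x) \<in> L2_space" "(\<lambda>x. u x - v x) \<in> L2_space" for n
    by (auto intro: L2_space_diff)
  have *: "(\<lambda>n. L2_norm (\<lambda>x. f n x - u x) + L2_norm (\<lambda>x. g n x - v x)) \<longlonglongrightarrow> 0"
    using f g by (intro tendsto_add_zero) (auto simp: L2_tendsto_iff)
  show "(\<lambda>n. L2_norm (\<lambda>x. f n x - g n x - (u x - v x))) \<longlonglongrightarrow> 0"
  proof (rule Lim_null_comparison[OF _ *], rule always_eventually, rule allI)
    fix n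
    have "L2_norm (\<lambda>x. (f n x - u x) + (v x - g n x)) \<le> L2_norm (\<lambda>x. f n x - u x) + L2_norm (\<lambda>x. v x - g n x)"
      by (intro L2_norm_triangle L2_space_diff F)
    then show "norm (L2_norm (\<lambda>x. f n x - g n x - (u x - v x))) \<le> L2_norm (\<lambda>x. f n x - u x) + L2_norm (\<lambda>x. g n x - v x)"
      by (simp add: L2_norm_minus_commute[of v] algebra_simps)
  qed
qed


text \<open>
  Dominated convergence in \<open>L\<^sup>2\<close>: the squared differences are dominated by \<open>4 |w|\<^sup>2\<close>.
\<close>

lemma L2_AE_dominated_tendsto:
  assumes f: "\<And>n. f n \<in> borel_measurable borel" and u: "u \<in> borel_measurable borel" and w: "w \<in> L2_space"
    and lim: "AE x in lborel. (\<lambda>n. f n x) \<longlonglongrightarrow> u x"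
    and bd: "\<And>n. AE x in lborel. cmod (f n x) \<le> cmod (w x)"
  shows "L2_tendsto f u"
proof -
  note [measurable] = f u L2_space_measurable[OF w]
  have bd': "AE x in lborel. \<forall>n. cmod (f n x) \<le> cmod (w x)"
    using bd by (simp add: AE_all_countable)
  have bdu: "AE x in lborel. cmod (u x) \<le> cmod (w x)"
    using lim bd'
  proof eventually_elim
    case (elim x)
    then show ?case by (intro tendsto_upperbound[OF tendsto_norm[OF elim(1)]]) auto
  qed
  have fL: "f n \<in> L2_space" for n
    by (rule L2_space_dominated[OF w, where C=1]) (use bd[of n] in auto)
  have uL: "u \<in> L2_space"
    by (rule L2_space_dominated[OF w, where C=1]) (use bdu in auto)
  have "(\<lambda>n. LINT x|lborel. (cmod (f n x - u x))\<^sup>2) \<longlonglongrightarrow> (LINT x|(lborel::'a measure). 0)"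
  proof (rule integral_dominated_convergence[where w="\<lambda>x. 4 * (cmod (w x))\<^sup>2" and s="\<lambda>n x. (cmod (f n x - u x))\<^sup>2"])
    show "integrable lborel (\<lambda>x. 4 * (cmod (w x))\<^sup>2)" using L2_space_integrable[OF w] by simp
    show "AE x in lborel. (\<lambda>n. (cmod (f n x - u x))\<^sup>2) \<longlonglongrightarrow> 0"
      using lim
    proof eventually_elim
      case (elim x)
      have "(\<lambda>n. (cmod (f n x - u x))\<^sup>2) \<longlonglongrightarrow> (cmod (u x - u x))\<^sup>2"
        by (intro tendsto_intros elim)
      then show ?case by simp
    qed
    show "AE x in lborel. norm ((cmod (f n x - u x))\<^sup>2) \<le> 4 * (cmod (w x))\<^sup>2" for n
      using bd[of n] bdu
    proof eventually_elim
      case (elim x)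
      have "cmod (f n x - u x) \<le> 2 * cmod (w x)"
        using norm_triangle_ineq4[of "f n x" "u x"] elim by simp
      then have "(cmod (f n x - u x))\<^sup>2 \<le> (2 * cmod (w x))\<^sup>2" by (intro power_mono) auto
      then show ?case by (simp add: power_mult_distrib)
    qed
  qed auto
  then show ?thesis using fL uL by (simp add: L2_tendsto_def)
qed


lemma L2_tendsto_inner:
  assumes f: "L2_tendsto f u" and g: "L2_tendsto g v"
  shows "(\<lambda>n. L2_inner (f n) (g n)) \<longlonglongrightarrow> L2_inner u v"
proof (rule Lim_transform2[OF tendsto_const])
  have F: "\<And>n. f n \<in> L2_space" "u \<in> L2_space" "\<And>n. g n \<in> L2_space" "v \<in> L2_space"
    using f g by (auto simp: L2_tendsto_iff)
  have "(\<lambda>n. L2_norm (\<lambda>x. f n x - u x) * L2_norm (g n) + L2_norm u * L2_norm (\<lambda>x. g n x - v x))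
      \<longlonglongrightarrow> 0 * L2_norm v + L2_norm u * 0"
    using f g by (intro tendsto_intros L2_tendsto_norm) (auto simp: L2_tendsto_iff)
  then have *: "(\<lambda>n. L2_norm (\<lambda>x. f n x - u x) * L2_norm (g n) + L2_norm u * L2_norm (\<lambda>x. g n x - v x)) \<longlonglongrightarrow> 0"
    by simp
  show "(\<lambda>n. L2_inner u v - L2_inner (f n) (g n)) \<longlonglongrightarrow> 0"
  proof (rule Lim_null_comparison[OF _ *], rule always_eventually, rule allI)
    fix n
    note I = L2_inner_integrable[OF F(2) F(4)] L2_inner_integrable[OF F(1) F(3), of n n]
       L2_inner_integrable[OF F(2) F(3), of n]
    have "L2_inner u v - L2_inner (f n) (g n)
        = - L2_inner (\<lambda>x. f n x - u x) (g n) - L2_inner u (\<lambda>x. g n x - v x)"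
      using I by (simp add: L2_inner_def algebra_simps)
    also have "cmod \<dots> \<le> cmod (L2_inner (\<lambda>x. f n x - u x) (g n)) + cmod (L2_inner u (\<lambda>x. g n x - v x))"
      by (metis norm_minus_cancel norm_triangle_ineq4)
    also have "\<dots> \<le> L2_norm (\<lambda>x. f n x - u x) * L2_norm (g n) + L2_norm u * L2_norm (\<lambda>x. g n x - v x)"
      by (intro add_mono L2_Cauchy_Schwarz L2_space_diff F)
    finally show "norm (L2_inner u v - L2_inner (f n) (g n))
       \<le> L2_norm (\<lambda>x. f n x - u x) * L2_norm (g n) + L2_norm u * L2_norm (\<lambda>x. g n x - v x)" .
  qed
qed

lemma L2_space_bounded_support:
  assumes [measurable]: "u \<in> borel_measurable borel" and "\<And>x. cmod (u x) \<le> M"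
    and "\<And>x. norm x > r \<Longrightarrow> u x = 0"
  shows "u \<in> L2_space" "u \<in> L1_space"
proof -
  have "AE x in lborel. norm (u x) \<le> norm (M * indicat_real (cball 0 r) x)"
    "AE x in lborel. norm ((cmod (u x))\<^sup>2) \<le> norm (M\<^sup>2 * indicat_real (cball 0 r) x)"
    using assms(2,3) by (auto simp: indicator_def not_le intro!: power_mono
       order_trans[OF _ abs_ge_self])
  moreover have int: "integrable lborel (\<lambda>x::'a. c * indicat_real (cball 0 r) x)" for c
    using emeasure_bounded_finite[OF bounded_cball, of 0 r]
    by (intro integrable_mult_right) (simp add: integrable_indicator_iff)
  ultimately show "u \<in> L2_space" "u \<in> L1_space"
    unfolding L2_space_def L1_space_def
    using Bochner_Integration.integrable_bound[OF int[of M], of u]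
      Bochner_Integration.integrable_bound[OF int[of "M\<^sup>2"], of "\<lambda>x. (cmod (u x))\<^sup>2"]
    by simp_all
qed

definition truncation :: "('a::euclidean_space \<Rightarrow> complex) \<Rightarrow> nat \<Rightarrow> 'a \<Rightarrow> complex" where
  "truncation u n x = (if norm x \<le> real n \<and> cmod (u x) \<le> real n then u x else 0)"

lemma
  assumes u: "u \<in> L2_space"
  shows measurable_truncation: "truncation u n \<in> borel_measurable borel"
    and truncation_tendsto_L2: "L2_tendsto (truncation u) u"
    and truncation_L1: "truncation u n \<in> L1_space"
proof -
  let ?t = "truncation u"
  note [measurable] = L2_space_measurable[OF u]
  show m [measurable]: "?t n \<in> borel_measurable borel" for n
    unfolding truncation_def[abs_def] by measurable
  show "L2_tendsto ?t u"
  proof (rule L2_AE_dominated_tendsto[OF m _ u])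
    have "(\<lambda>n. ?t n x) \<longlonglongrightarrow> u x" for x
    proof (rule tendsto_eventually)
      obtain N where "max (norm x) (cmod (u x)) \<le> real N" using real_arch_simple by blast
      then have "\<forall>n\<ge>N. ?t n x = u x" by (auto simp: truncation_def)
      then show "\<forall>\<^sub>F n in sequentially. ?t n x = u x" by (auto simp: eventually_sequentially)
    qed
    then show "AE x in lborel. (\<lambda>n. ?t n x) \<longlonglongrightarrow> u x" by simp
  qed (auto simp: truncation_def)
  show "?t n \<in> L1_space" for n
    by (rule L2_space_bounded_support[where M="real n" and r="real n"]) (simp, auto simp: truncation_def)
qed

text \<open>
  A truncation of \<open>u\<close> is almost everywhere the limit of continuous functions \<open>G k\<close>. Rescaling
  their values into the ball of radius \<open>N\<close> and multiplying by a continuous cut-off keeps this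
  limit and makes dominated convergence applicable.
\<close>

lemma compactly_supported_continuous_dense:
  assumes u: "u \<in> L2_space" and e: "0 < e"
  obtains g r M where "continuous_on UNIV g" "\<forall>x. cmod (g x) \<le> M" "\<forall>x. norm x > r \<longrightarrow> g x = 0"
    "L2_norm (\<lambda>x. u x - g x) < e"
proof -
  let ?t = "truncation u"
  note t = measurable_truncation[OF u] truncation_tendsto_L2[OF u]
  have "(\<lambda>n. L2_norm (\<lambda>x. ?t n x - u x)) \<longlonglongrightarrow> 0" using t(2) by (simp add: L2_tendsto_iff)
  then have "\<forall>\<^sub>F n in sequentially. L2_norm (\<lambda>x. ?t n x - u x) < e/2"
    using e by (intro order_tendstoD(2)) auto
  moreover have "\<forall>\<^sub>F n in sequentially. n > 0" by (rule eventually_gt_at_top)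
  ultimately have "\<forall>\<^sub>F n in sequentially. L2_norm (\<lambda>x. ?t n x - u x) < e/2 \<and> n > 0"
    by eventually_elim auto
  then obtain n where n: "L2_norm (\<lambda>x. ?t n x - u x) < e/2" "n > 0"
    by (auto simp: eventually_sequentially)
  define h where "h = ?t n"
  define N where "N = real n"
  have N: "N > 0" using n by (simp add: N_def)
  have h: "h \<in> borel_measurable borel" "h \<in> L2_space"
    using t by (auto simp: h_def L2_tendsto_iff)
  have hN: "cmod (h x) \<le> N" "norm x > N \<Longrightarrow> h x = 0" for x
    using N by (auto simp: h_def truncation_def N_def)
  have "h \<in> borel_measurable lebesgue" using h(1) by (simp add: measurable_completion)
  then have "h measurable_on UNIV" by (intro lebesgue_measurable_imp_measurable_on) auto
  then obtain Z G where Z: "negligible Z" and G: "\<And>n. continuous_on UNIV (G n)"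
    and lim: "\<And>x. x \<notin> Z \<Longrightarrow> (\<lambda>n. G n x) \<longlonglongrightarrow> h x"
    unfolding measurable_on_def by auto
  have Zae: "AE x in lborel. x \<notin> Z"
  proof -
    have "AE x in lebesgue. x \<notin> Z"
      using Z by (intro AE_not_in) (simp add: negligible_iff_null_sets)
    then show ?thesis by (simp add: AE_completion_iff)
  qed
  define cut where "cut = (\<lambda>x::'a. max 0 (min 1 (N + 1 - norm x)))"
  define g where "g = (\<lambda>k x. complex_of_real (cut x * (N / max N (cmod (G k x)))) * G k x)"
  have cut: "0 \<le> cut x" "cut x \<le> 1" "norm x \<le> N \<Longrightarrow> cut x = 1" "norm x > N + 1 \<Longrightarrow> cut x = 0" for x
    by (auto simp: cut_def)
  have gc: "continuous_on UNIV (g k)" for k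
    unfolding g_def cut_def using N by (intro continuous_intros G) auto
  have gb: "cmod (g k x) \<le> N" for k x
  proof -
    have "cmod (g k x) = cut x * (N * cmod (G k x) / max N (cmod (G k x)))"
      using N cut(1)[of x] by (simp add: g_def norm_mult norm_divide)
    also have "\<dots> \<le> 1 * N"
      using N cut[of x] by (intro mult_mono) (auto simp: field_simps max_def)
    finally show ?thesis by simp
  qed
  have g0: "norm x > N + 1 \<Longrightarrow> g k x = 0" for k x by (simp add: g_def cut)
  have "L2_tendsto g h"
  proof (rule L2_AE_dominated_tendsto[where w="\<lambda>x. complex_of_real (N * indicat_real (cball 0 (N+1)) x)"])
    show "g k \<in> borel_measurable borel" for k
      by (rule borel_measurable_continuous_onI[OF gc])
    show "(\<lambda>x::'a. complex_of_real (N * indicat_real (cball 0 (N+1)) x)) \<in> L2_space"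
      by (rule L2_space_bounded_support[where M=N and r="N+1"])
         (use N in \<open>auto simp: indicator_def\<close>)
    show "AE x in lborel. (\<lambda>k. g k x) \<longlonglongrightarrow> h x"
      using Zae
    proof eventually_elim
      case (elim x)
      have "(\<lambda>k. g k x) \<longlonglongrightarrow> complex_of_real (cut x * (N / max N (cmod (h x)))) * h x"
        unfolding g_def using N by (intro tendsto_intros lim elim) auto
      also have "complex_of_real (cut x * (N / max N (cmod (h x)))) * h x = h x"
        using hN[of x] N cut(3)[of x] by (cases "norm x \<le> N") (auto simp: max_def)
      finally show ?case .
    qed
    show "AE x in lborel. cmod (g k x) \<le> cmod (complex_of_real (N * indicat_real (cball 0 (N+1)) x))" for k
      using gb[of k] g0 N by (intro AE_I2) (auto simp: indicator_def not_le)
  qed (use h in auto)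
  then have "(\<lambda>n. L2_norm (\<lambda>x. g n x - h x)) \<longlonglongrightarrow> 0" by (simp add: L2_tendsto_iff)
  then have "\<forall>\<^sub>F n in sequentially. L2_norm (\<lambda>x. g n x - h x) < e/2"
    using e by (intro order_tendstoD(2)) auto
  then obtain k where k: "L2_norm (\<lambda>x. g k x - h x) < e/2" by (auto simp: eventually_sequentially)
  have gL: "g k \<in> L2_space" using \<open>L2_tendsto g h\<close> by (simp add: L2_tendsto_iff)
  show thesis
  proof (rule that[OF gc])
    show "\<forall>x. cmod (g k x) \<le> N" "\<forall>x. norm x > N + 1 \<longrightarrow> g k x = 0" using gb g0 by auto
    have "L2_norm (\<lambda>x. u x - g k x) \<le> L2_norm (\<lambda>x. u x - h x) + L2_norm (\<lambda>x. h x - g k x)"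
      by (rule L2_norm_triangle_diff[OF u h(2) gL])
    also have "\<dots> < e"
      using k n(1) L2_norm_minus_commute[of h "g k"] L2_norm_minus_commute[of h u] by (simp add: h_def)
    finally show "L2_norm (\<lambda>x. u x - g k x) < e" .
  qed
qed

section \<open>Gaussians and their transforms\<close>

lemma
  fixes f :: "'a::euclidean_space \<Rightarrow> real \<Rightarrow> complex"
  assumes f: "\<And>b. b \<in> Basis \<Longrightarrow> integrable lborel (f b)"
  shows integrable_lborel_prod: "integrable lborel (\<lambda>x::'a. \<Prod>b\<in>Basis. f b (x \<bullet> b))"
    and integral_lborel_prod: "(LINT x|lborel. (\<Prod>b\<in>Basis. f b (x \<bullet> b))) = (\<Prod>b\<in>Basis. LINT t|lborel. f b t)"
proof -
  interpret product_sigma_finite "\<lambda>b::'a. lborel :: real measure" ..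
  have meas [measurable]: "(\<lambda>x::'a. \<Prod>b\<in>Basis. f b (x \<bullet> b)) \<in> borel_measurable borel"
  proof (intro borel_measurable_prod)
    fix b :: 'a assume "b \<in> Basis"
    then have [measurable]: "f b \<in> borel_measurable borel" using f[of b] by auto
    show "(\<lambda>x. f b (x \<bullet> b)) \<in> borel_measurable borel" by measurable
  qed
  have eq: "(\<Prod>b\<in>Basis. f b ((\<Sum>i\<in>Basis. g i *\<^sub>R i) \<bullet> b)) = (\<Prod>b\<in>Basis. f b (g b))" for g
    by (intro prod.cong refl) simp
  have m [measurable]: "(\<lambda>g. \<Sum>i\<in>(Basis::'a set). g i *\<^sub>R i) \<in> borel_measurable (\<Pi>\<^sub>M b\<in>(Basis::'a set). lborel)"
    by measurable
  have "integrable (\<Pi>\<^sub>M b\<in>(Basis::'a set). lborel) (\<lambda>g. \<Prod>b\<in>Basis. f b (g b))"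
    by (rule product_integrable_prod) (auto intro: f)
  then show "integrable lborel (\<lambda>x::'a. \<Prod>b\<in>Basis. f b (x \<bullet> b))"
    by (subst lborel_eq, subst integrable_distr_eq[OF m meas]) (simp only: eq)
  have "(LINT x|lborel. (\<Prod>b\<in>Basis. f b (x \<bullet> b))) = integral\<^sup>L (\<Pi>\<^sub>M b\<in>(Basis::'a set). lborel) (\<lambda>g. \<Prod>b\<in>Basis. f b (g b))"
    by (subst lborel_eq, subst integral_distr[OF m meas]) (simp only: eq)
  also have "\<dots> = (\<Prod>b\<in>Basis. LINT t|lborel. f b t)"
    by (rule product_integral_prod) (auto intro: f)
  finally show "(LINT x|lborel. (\<Prod>b\<in>Basis. f b (x \<bullet> b))) = (\<Prod>b\<in>Basis. LINT t|lborel. f b t)" .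
qed

text \<open>
  This is the characteristic function of the standard normal distribution at frequency \<open>s\<close>, after
  the change of variables \<open>c y\<close> that turns the normal density into the Gaussian of scale \<open>\<delta>\<close>.
\<close>

lemma
  fixes \<delta> t :: real
  assumes d: "0 < \<delta>"
  shows integrable_gauss_char_real:
      "integrable lborel (\<lambda>y. exp (- (\<i> * 2 * pi * (t * y))) * complex_of_real (exp (- pi * (\<delta> * y)\<^sup>2)))"
    and integral_gauss_char_real:
      "(LINT y|lborel. exp (- (\<i> * 2 * pi * (t * y))) * complex_of_real (exp (- pi * (\<delta> * y)\<^sup>2)))
        = complex_of_real (exp (- pi * (t / \<delta>)\<^sup>2) / \<delta>)"
proof -
  define s where "s = - (sqrt (2 * pi) * t / \<delta>)"
  define c where "c = sqrt (2 * pi) * \<delta>"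
  have c: "c > 0" using d by (simp add: c_def)
  let ?F = "\<lambda>x. complex_of_real (std_normal_density x) * iexp (s * x)"
  let ?G = "\<lambda>y. exp (- (\<i> * 2 * pi * (t * y))) * complex_of_real (exp (- pi * (\<delta> * y)\<^sup>2))"
  have sc: "s * c = - 2 * pi * t"
    using d by (simp add: s_def c_def)
  have FG: "?F (0 + c * y) = ?G y / sqrt (2 * pi)" for y
  proof -
    have 1: "(c * y)\<^sup>2 / 2 = pi * (\<delta> * y)\<^sup>2" by (simp add: c_def power_mult_distrib)
    have 2: "s * (c * y) = - 2 * pi * t * y" by (simp add: sc flip: mult.assoc)
    show ?thesis
      by (simp add: std_normal_density_def 1 2 of_real_exp mult.assoc)
  qed
  have "integrable lborel (\<lambda>x. std_normal_density x *\<^sub>R iexp (s * x))"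
    by (subst integrable_density[symmetric])
       (auto simp: normal_density_nonneg intro!: finite_measure.integrable_const_bound[where B=1] prob_space.finite_measure prob_space_normal_density)
  then have I: "integrable lborel ?F" by (simp add: scaleR_conv_of_real)
  then have "integrable lborel (\<lambda>y. ?F (0 + c * y))"
    using c by (intro lborel_integrable_real_affine) auto
  then have "integrable lborel (\<lambda>y. ?G y / sqrt (2 * pi))" by (simp only: FG)
  then have "integrable lborel (\<lambda>y. complex_of_real (sqrt (2 * pi)) * (?G y / sqrt (2 * pi)))"
    by (rule integrable_mult_right)
  then show "integrable lborel ?G" by simp
  have "char std_normal_distribution s = (LINT x|lborel. std_normal_density x *\<^sub>R iexp (s * x))"
    unfolding char_def by (subst integral_density) (auto simp: normal_density_nonneg)
  then have "complex_of_real (exp (- (s\<^sup>2) / 2)) = (LINT x|lborel. ?F x)"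
    by (simp add: char_std_normal_distribution scaleR_conv_of_real)
  also have "\<dots> = c *\<^sub>R (LINT y|lborel. ?F (0 + c * y))"
    using c by (subst lborel_integral_real_affine[where c=c and t=0]) auto
  also have "\<dots> = c *\<^sub>R (LINT y|lborel. ?G y / sqrt (2 * pi))" by (simp only: FG)
  also have "\<dots> = \<delta> * (LINT y|lborel. ?G y)"
    by (simp add: c_def scaleR_conv_of_real)
  finally have "(LINT y|lborel. ?G y) = complex_of_real (exp (- (s\<^sup>2) / 2)) / \<delta>"
    using d by (simp add: field_simps)
  moreover have "s\<^sup>2 / 2 = pi * (t / \<delta>)\<^sup>2" by (simp add: s_def power_mult_distrib power_divide)
  ultimately show "(LINT y|lborel. ?G y) = complex_of_real (exp (- pi * (t / \<delta>)\<^sup>2) / \<delta>)" by simp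
qed

text \<open>
  The scale \<open>\<delta>\<close> enters so that \<open>heat_kernel \<delta>\<close>, the transform of \<open>gauss \<delta>\<close>, concentrates at the
  origin as \<open>\<delta>\<close> tends to 0, while \<open>gauss \<delta>\<close> increases to 1.
\<close>

definition gauss :: "real \<Rightarrow> 'a::euclidean_space \<Rightarrow> real" where
  "gauss \<delta> x = exp (- pi * (\<delta> * norm x)\<^sup>2)"

definition heat_kernel :: "real \<Rightarrow> 'a::euclidean_space \<Rightarrow> real" where
  "heat_kernel \<delta> x = gauss (1 / \<delta>) x / \<delta> ^ DIM('a)"

lemma gauss_eq_prod: "gauss \<delta> x = (\<Prod>b\<in>Basis. exp (- pi * (\<delta> * (x \<bullet> b))\<^sup>2))"
proof -
  have "(norm x)\<^sup>2 = (\<Sum>b\<in>Basis. (x \<bullet> b)\<^sup>2)"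
    unfolding power2_norm_eq_inner by (subst euclidean_inner) (simp add: power2_eq_square)
  then show ?thesis
    by (simp add: gauss_def exp_sum[symmetric] power_mult_distrib sum_distrib_left sum_negf)
qed

lemma borel_measurable_gauss [measurable]: "gauss \<delta> \<in> borel_measurable borel"
  unfolding gauss_def[abs_def] by measurable

lemma borel_measurable_heat_kernel [measurable]: "heat_kernel \<delta> \<in> borel_measurable borel"
  unfolding heat_kernel_def[abs_def] by measurable

lemma gauss_pos: "gauss \<delta> x > 0" by (simp add: gauss_def)
lemma gauss_le_1: "gauss \<delta> x \<le> 1" by (simp add: gauss_def)
lemma gauss_minus [simp]: "gauss \<delta> (- x) = gauss \<delta> x" by (simp add: gauss_def)

lemma heat_kernel_pos: "0 < \<delta> \<Longrightarrow> heat_kernel \<delta> x > 0" by (simp add: heat_kernel_def gauss_pos)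
lemma heat_kernel_minus [simp]: "heat_kernel \<delta> (- x) = heat_kernel \<delta> x" by (simp add: heat_kernel_def)
lemma heat_kernel_bound: "0 < \<delta> \<Longrightarrow> heat_kernel \<delta> (x::'a::euclidean_space) \<le> 1 / \<delta> ^ DIM('a)"
  using gauss_le_1[of "1/\<delta>" x] by (simp add: heat_kernel_def divide_right_mono)

text \<open>Characters and Gaussians factor over the coordinates, which reduces the transform to dimension one.\<close>

lemma gauss_char_eq_prod:
  fixes x \<xi> :: "'a::euclidean_space"
  shows "exp (- (\<i> * 2 * pi * (\<xi> \<bullet> x))) * complex_of_real (gauss \<delta> x)
    = (\<Prod>b\<in>Basis. exp (- (\<i> * 2 * pi * ((\<xi> \<bullet> b) * (x \<bullet> b)))) * complex_of_real (exp (- pi * (\<delta> * (x \<bullet> b))\<^sup>2)))"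
  unfolding prod.distrib gauss_eq_prod of_real_prod
  by (subst exp_sum[symmetric])
     (simp_all add: euclidean_inner[of \<xi> x] sum_distrib_left sum_negf)

lemma
  fixes \<xi> :: "'a::euclidean_space"
  assumes d: "0 < \<delta>"
  shows integrable_gauss_char: "integrable lborel (\<lambda>x. exp (- (\<i> * 2 * pi * (\<xi> \<bullet> x))) * complex_of_real (gauss \<delta> x))"
    and fourier_gauss: "fourier_L1 (\<lambda>x. complex_of_real (gauss \<delta> x)) \<xi> = heat_kernel \<delta> \<xi>"
proof -
  show "integrable lborel (\<lambda>x. exp (- (\<i> * 2 * pi * (\<xi> \<bullet> x))) * complex_of_real (gauss \<delta> x))"
    unfolding gauss_char_eq_prod by (intro integrable_lborel_prod integrable_gauss_char_real d)
  have "fourier_L1 (\<lambda>x. complex_of_real (gauss \<delta> x)) \<xi>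
      = (\<Prod>b\<in>Basis. complex_of_real (exp (- pi * ((\<xi> \<bullet> b) / \<delta>)\<^sup>2) / \<delta>))"
    unfolding fourier_L1_def gauss_char_eq_prod
    by (subst integral_lborel_prod[OF integrable_gauss_char_real[OF d]])
       (simp only: integral_gauss_char_real[OF d])
  also have "\<dots> = heat_kernel \<delta> \<xi>"
    by (simp add: heat_kernel_def gauss_eq_prod prod_dividef)
  finally show "fourier_L1 (\<lambda>x. complex_of_real (gauss \<delta> x)) \<xi> = heat_kernel \<delta> \<xi>" .
qed

lemma integrable_gauss: "0 < \<delta> \<Longrightarrow> integrable lborel (gauss \<delta>)"
  using integrable_norm[OF integrable_gauss_char[of \<delta> 0]]
  by (simp add: less_imp_le gauss_pos)

lemma gauss_L2: "0 < \<delta> \<Longrightarrow> (\<lambda>x. complex_of_real (gauss \<delta> x)) \<in> L2_space"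
proof (rule L2_spaceI)
  assume d: "0 < \<delta>"
  show "integrable lborel (\<lambda>x. (cmod (complex_of_real (gauss \<delta> x)))\<^sup>2)"
    by (rule Bochner_Integration.integrable_bound[OF integrable_gauss[OF d]])
       (auto simp: power2_eq_square gauss_le_1 less_imp_le[OF gauss_pos] intro!: mult_left_le)
qed simp

section \<open>Completeness\<close>

text \<open>
  Multiplication by a Gaussian turns a Cauchy sequence in \<open>L\<^sup>2\<close> into one in \<open>L\<^sup>1\<close>, where a subsequence
  converges almost everywhere. As the Gaussian has no zeros, the original subsequence converges
  almost everywhere too, and Fatou's lemma upgrades this to convergence in \<open>L\<^sup>2\<close>.
\<close>

lemma L2_complete:
  fixes f :: "nat \<Rightarrow> 'a::euclidean_space \<Rightarrow> complex"
  assumes f: "\<And>n. f n \<in> L2_space"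
    and cauchy: "\<And>e. 0 < e \<Longrightarrow> \<exists>N. \<forall>m\<ge>N. \<forall>n\<ge>N. L2_norm (\<lambda>x. f m x - f n x) < e"
  obtains u where "L2_tendsto f u"
proof -
  note [measurable] = L2_space_measurable[OF f]
  define W where "W = (\<lambda>x::'a. complex_of_real (gauss 1 x))"
  have W: "W \<in> L2_space" "W x \<noteq> 0" for x
    using gauss_L2[of 1] gauss_pos[of 1 x] by (auto simp: W_def)
  define F where "F = (\<lambda>n x. f n x * W x)"
  have Wc: "cnj (W x) = W x" for x by (simp add: W_def)
  have FI: "integrable lborel (F n)" for n
    using L2_inner_integrable[OF f[of n] W(1)] by (simp add: F_def Wc)
  have "\<exists>N. \<forall>i\<ge>N. \<forall>j\<ge>N. (LINT x|lborel. norm (F i x - F j x)) < e" if e: "e > 0" for e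
  proof -
    have "e / (L2_norm W + 1) > 0" using e by (simp add: add_nonneg_pos)
    from cauchy[OF this] obtain N where N: "\<And>m n. m \<ge> N \<Longrightarrow> n \<ge> N \<Longrightarrow> L2_norm (\<lambda>x. f m x - f n x) < e / (L2_norm W + 1)"
      by blast
    have "(LINT x|lborel. norm (F i x - F j x)) < e" if "i \<ge> N" "j \<ge> N" for i j
    proof -
      have "(LINT x|lborel. norm (F i x - F j x)) = (LINT x|lborel. cmod (f i x - f j x) * cmod (W x))"
        by (simp add: F_def flip: norm_mult left_diff_distrib)
      also have "\<dots> \<le> L2_norm (\<lambda>x. f i x - f j x) * L2_norm W"
        by (rule L2_Cauchy_Schwarz_cmod[OF L2_space_diff[OF f f] W(1)])
      also have "\<dots> \<le> L2_norm (\<lambda>x. f i x - f j x) * (L2_norm W + 1)" by (intro mult_left_mono) auto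
      also have "\<dots> < e" using N[OF that] by (simp add: pos_less_divide_eq add_nonneg_pos)
      finally show ?thesis .
    qed
    then show ?thesis by blast
  qed
  from cauchy_L1_AE_cauchy_subseq[OF FI this]
  obtain r where r: "strict_mono r" "AE x in lborel. Cauchy (\<lambda>i. F (r i) x)" by blast
  define u where "u = (\<lambda>x. lim (\<lambda>i. f (r i) x))"
  have [measurable]: "u \<in> borel_measurable borel" unfolding u_def by measurable
  have lim: "AE x in lborel. (\<lambda>i. f (r i) x) \<longlonglongrightarrow> u x"
    using r(2)
  proof eventually_elim
    case (elim x)
    then obtain l where "(\<lambda>i. F (r i) x) \<longlonglongrightarrow> l" using Cauchy_convergent_iff convergent_def by blast
    then have "(\<lambda>i. F (r i) x / W x) \<longlonglongrightarrow> l / W x" using W(2) by (intro tendsto_intros)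
    then have "convergent (\<lambda>i. f (r i) x)" using W(2) by (auto simp: F_def convergent_def)
    then show ?case by (simp add: u_def convergent_LIMSEQ_iff)
  qed
    \<comment> \<open>Distances to the pointwise limit are bounded by distances within the tail of the sequence.\<close>
  have fatou: "(\<lambda>x. f n x - u x) \<in> L2_space \<and> L2_norm (\<lambda>x. f n x - u x) \<le> e"
    if e: "e > 0" and N: "\<And>m. m \<ge> N \<Longrightarrow> L2_norm (\<lambda>x. f n x - f m x) < e" for e n N
  proof -
    have "(\<integral>\<^sup>+x. ennreal ((cmod (f n x - u x))\<^sup>2) \<partial>lborel)
        \<le> (\<integral>\<^sup>+x. liminf (\<lambda>i. ennreal ((cmod (f n x - f (r i) x))\<^sup>2)) \<partial>lborel)"
    proof (rule nn_integral_mono_AE)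
      show "AE x in lborel. ennreal ((cmod (f n x - u x))\<^sup>2) \<le> liminf (\<lambda>i. ennreal ((cmod (f n x - f (r i) x))\<^sup>2))"
        using lim
      proof eventually_elim
        case (elim x)
        have "(\<lambda>i. ennreal ((cmod (f n x - f (r i) x))\<^sup>2)) \<longlonglongrightarrow> ennreal ((cmod (f n x - u x))\<^sup>2)"
          by (intro tendsto_intros tendsto_ennrealI elim)
        from lim_imp_Liminf[OF _ this] show ?case by simp
      qed
    qed
    also have "\<dots> \<le> liminf (\<lambda>i. \<integral>\<^sup>+x. ennreal ((cmod (f n x - f (r i) x))\<^sup>2) \<partial>lborel)"
      by (rule nn_integral_liminf) simp
    also have "\<dots> \<le> ennreal (e\<^sup>2)"
    proof (rule Liminf_le)
      show "\<forall>\<^sub>F i in sequentially. (\<integral>\<^sup>+x. ennreal ((cmod (f n x - f (r i) x))\<^sup>2) \<partial>lborel) \<le> ennreal (e\<^sup>2)"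
        using eventually_ge_at_top[of N]
      proof eventually_elim
        case (elim i)
        have "r i \<ge> N" using seq_suble[OF r(1), of i] elim by simp
        then have "(L2_norm (\<lambda>x. f n x - f (r i) x))\<^sup>2 \<le> e\<^sup>2"
          using N[of "r i"] by (intro power_mono) auto
        then show ?case
          using nn_integral_eq_integral[OF L2_space_integrable[OF L2_space_diff[OF f f]], of n "r i"]
          by (simp add: L2_norm_square ennreal_leI)
      qed
    qed simp
    finally have le: "(\<integral>\<^sup>+x. ennreal ((cmod (f n x - u x))\<^sup>2) \<partial>lborel) \<le> ennreal (e\<^sup>2)" .
    have int: "integrable lborel (\<lambda>x. (cmod (f n x - u x))\<^sup>2)"
      using le by (intro integrableI_nonneg) (auto simp: top_unique intro: le_less_trans[OF _ ennreal_less_top])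
    then have "(\<lambda>x. f n x - u x) \<in> L2_space" by (intro L2_spaceI) auto
    moreover have "(L2_norm (\<lambda>x. f n x - u x))\<^sup>2 \<le> e\<^sup>2"
      using le nn_integral_eq_integral[OF int] by (simp add: L2_norm_square)
    ultimately show ?thesis using e by (auto intro: power2_le_imp_le)
  qed
  have main: "\<exists>N. \<forall>n\<ge>N. (\<lambda>x. f n x - u x) \<in> L2_space \<and> L2_norm (\<lambda>x. f n x - u x) \<le> e" if "e > 0" for e
    using cauchy[OF that] fatou[OF that] by blast
  from main[of 1] obtain n where "(\<lambda>x. f n x - u x) \<in> L2_space" by auto
  from L2_space_diff[OF f[of n] this] have uL: "u \<in> L2_space" by simp
  show thesis
  proof
    show "L2_tendsto f u"
      unfolding L2_tendsto_iff
    proof (intro conjI allI f uL LIMSEQ_I)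
      fix e :: real assume "e > 0"
      with main[of "e/2"] obtain N where "\<And>n. n \<ge> N \<Longrightarrow> L2_norm (\<lambda>x. f n x - u x) \<le> e/2" by auto
      moreover have "e / 2 < e" using \<open>e > 0\<close> by simp
      ultimately have "\<And>n. n \<ge> N \<Longrightarrow> L2_norm (\<lambda>x. f n x - u x) < e" using le_less_trans by blast
      then show "\<exists>N. \<forall>n\<ge>N. norm (L2_norm (\<lambda>x. f n x - u x) - 0) < e"
        by (intro exI[of _ N]) simp
    qed
  qed
qed

section \<open>Transforms of integrable functions\<close>

lemma distr_lborel_reflect:
  fixes x :: "'a::euclidean_space"
  shows "distr lborel borel (\<lambda>y. x - y) = lborel"
  using lborel_affine[of "-1" x] by (simp add: density_1)

lemma nn_integral_lborel_reflect:
  fixes x :: "'a::euclidean_space"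
  assumes [measurable]: "f \<in> borel_measurable borel"
  shows "(\<integral>\<^sup>+y. f (x - y) \<partial>lborel) = (\<integral>\<^sup>+y. f y \<partial>lborel)"
  by (subst (2) distr_lborel_reflect[of x, symmetric], subst nn_integral_distr) auto

lemma integrable_lborel_reflect:
  fixes x :: "'a::euclidean_space" and f :: "'a \<Rightarrow> 'b::{banach, second_countable_topology}"
  assumes f: "integrable lborel f"
  shows "integrable lborel (\<lambda>y. f (x - y))"
proof -
  have [measurable]: "f \<in> borel_measurable borel" using f by auto
  show ?thesis
    using f by (subst (asm) distr_lborel_reflect[of x, symmetric], subst (asm) integrable_distr_eq) auto
qed

lemma integral_lborel_reflect:
  fixes x :: "'a::euclidean_space" and f :: "'a \<Rightarrow> 'b::{banach, second_countable_topology}"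
  assumes [measurable]: "f \<in> borel_measurable borel"
  shows "(LINT y|lborel. f (x - y)) = (LINT y|lborel. f y)"
  by (subst (2) distr_lborel_reflect[of x, symmetric], subst integral_distr) auto

lemma nn_integral_lborel_translate:
  fixes c :: "'a::euclidean_space"
  assumes [measurable]: "f \<in> borel_measurable borel"
  shows "(\<integral>\<^sup>+y. f (y - c) \<partial>lborel) = (\<integral>\<^sup>+y. f y \<partial>lborel)"
  by (subst (2) lborel_distr_plus[of "-c", symmetric], subst nn_integral_distr) auto

lemma integrable_lborel_translate:
  fixes c :: "'a::euclidean_space" and f :: "'a \<Rightarrow> 'b::{banach, second_countable_topology}"
  assumes f: "integrable lborel f"
  shows "integrable lborel (\<lambda>y. f (y - c))"
proof -
  have [measurable]: "f \<in> borel_measurable borel" using f by auto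
  show ?thesis
    using f by (subst (asm) lborel_distr_plus[of "-c", symmetric], subst (asm) integrable_distr_eq) auto
qed

lemma integral_lborel_translate:
  fixes c :: "'a::euclidean_space" and f :: "'a \<Rightarrow> 'b::{banach, second_countable_topology}"
  assumes [measurable]: "f \<in> borel_measurable borel"
  shows "(LINT y|lborel. f (y - c)) = (LINT y|lborel. f y)"
  by (subst (2) lborel_distr_plus[of "-c", symmetric], subst integral_distr) auto

lemma norm_cis_inner [simp]: "cmod (exp (- (\<i> * 2 * complex_of_real pi * complex_of_real t))) = 1"
  by (simp add: norm_exp_eq_Re)

lemma integrable_fourier:
  assumes u: "u \<in> L1_space"
  shows "integrable lborel (\<lambda>x. exp (- (\<i> * 2 * pi * (\<xi> \<bullet> x))) * u x)"
proof -
  have u': "integrable lborel u" using u by (simp add: L1_space_def)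
  then have [measurable]: "u \<in> borel_measurable borel" by auto
  show ?thesis
    by (rule Bochner_Integration.integrable_bound[OF u']) (auto simp: norm_mult)
qed

lemma L1_space_measurable [measurable_dest]: "u \<in> L1_space \<Longrightarrow> u \<in> borel_measurable borel"
  by (auto simp: L1_space_def)

lemma borel_measurable_fourier_L1:
  assumes [measurable]: "u \<in> borel_measurable borel"
  shows "fourier_L1 u \<in> borel_measurable borel"
  unfolding fourier_L1_def[abs_def] by measurable

lemma fourier_L1_bound:
  assumes u: "u \<in> L1_space"
  shows "cmod (fourier_L1 u \<xi>) \<le> (LINT x|lborel. cmod (u x))"
proof -
  have "cmod (fourier_L1 u \<xi>) \<le> (LINT x|lborel. cmod (exp (- (\<i> * 2 * pi * (\<xi> \<bullet> x))) * u x))"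
    unfolding fourier_L1_def by (rule integral_norm_bound)
  then show ?thesis by (simp add: norm_mult)
qed

lemma fourier_L1_diff:
  assumes "u \<in> L1_space" "v \<in> L1_space"
  shows "fourier_L1 (\<lambda>x. u x - v x) \<xi> = fourier_L1 u \<xi> - fourier_L1 v \<xi>"
  using integrable_fourier[OF assms(1), of \<xi>] integrable_fourier[OF assms(2), of \<xi>]
  by (simp add: fourier_L1_def algebra_simps)

lemma fourier_L1_cnj: "fourier_L1 (\<lambda>x. cnj (u x)) \<xi> = cnj (fourier_L1 u (- \<xi>))"
proof -
  have "(LINT x|lborel. exp (- (\<i> * 2 * pi * (\<xi> \<bullet> x))) * cnj (u x))
      = (LINT x|lborel. cnj (exp (- (\<i> * 2 * pi * ((- \<xi>) \<bullet> x))) * u x))"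
    by (simp add: exp_cnj)
  then show ?thesis by (simp only: fourier_L1_def Bochner_Integration.integral_cnj)
qed

lemma fourier_L1_minus:
  assumes [measurable]: "u \<in> borel_measurable borel"
  shows "fourier_L1 (\<lambda>x. u (- x)) \<xi> = fourier_L1 u (- \<xi>)"
  unfolding fourier_L1_def
  using integral_lborel_reflect[of "\<lambda>x. exp (- (\<i> * 2 * pi * (- \<xi> \<bullet> x))) * u x" 0] by simp

lemma integrable_tensor_bounded:
  fixes f :: "'a::euclidean_space \<Rightarrow> complex" and g :: "'b::euclidean_space \<Rightarrow> complex"
  assumes f: "integrable lborel f" and g: "integrable lborel g"
    and m [measurable]: "h \<in> borel_measurable borel" and h: "\<And>p. cmod (h p) \<le> 1"
  shows "integrable (lborel \<Otimes>\<^sub>M lborel) (\<lambda>(x, y). h (x, y) * f x * g y)"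
proof -
  have [measurable]: "f \<in> borel_measurable borel" "g \<in> borel_measurable borel" using f g by auto
  have h' [measurable]: "h \<in> borel_measurable (borel \<Otimes>\<^sub>M borel)" using m by (simp add: borel_prod)
  have "integrable (lborel \<Otimes>\<^sub>M lborel) (\<lambda>(x, y). f x * g y)"
    by (rule lborel_pair.Fubini_integrable) (use f g in \<open>auto simp: norm_mult\<close>)
  then show ?thesis
  proof (rule Bochner_Integration.integrable_bound)
    show "(\<lambda>(x, y). h (x, y) * f x * g y) \<in> borel_measurable (lborel \<Otimes>\<^sub>M lborel)" by measurable
    show "AE x in lborel \<Otimes>\<^sub>M lborel. norm (case x of (x, y) \<Rightarrow> h (x, y) * f x * g y) \<le> norm (case x of (x, y) \<Rightarrow> f x * g y)"
      using h by (auto simp: norm_mult mult.assoc intro!: AE_I2 mult_left_le_one_le)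
  qed
qed

text \<open>
  The symmetry of the kernel \<open>exp (- 2 \<pi> \<i> \<langle>\<xi>, x\<rangle>)\<close>, combined with Fubini's theorem.
\<close>

lemma fourier_multiplication_formula:
  fixes f g :: "'a::euclidean_space \<Rightarrow> complex"
  assumes f: "f \<in> L1_space" and g: "g \<in> L1_space"
  shows "(LINT \<xi>|lborel. fourier_L1 f \<xi> * g \<xi>) = (LINT x|lborel. f x * fourier_L1 g x)"
proof -
  let ?h = "\<lambda>p::'a \<times> 'a. exp (- (\<i> * 2 * pi * (fst p \<bullet> snd p)))"
  have "?h \<in> borel_measurable borel"
    by (intro borel_measurable_continuous_onI continuous_intros)
  then have "integrable (lborel \<Otimes>\<^sub>M lborel) (\<lambda>(\<xi>, x). ?h (\<xi>, x) * g \<xi> * f x)"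
    using f g by (intro integrable_tensor_bounded) (auto simp: L1_space_def)
  then have F: "(LINT \<xi>|lborel. LINT x|lborel. ?h (\<xi>, x) * g \<xi> * f x) = (LINT x|lborel. LINT \<xi>|lborel. ?h (\<xi>, x) * g \<xi> * f x)"
    by (intro lborel_pair.Fubini_integral[symmetric])
  have F1: "(LINT \<xi>|lborel. fourier_L1 f \<xi> * g \<xi>) = (LINT \<xi>|lborel. LINT x|lborel. ?h (\<xi>, x) * g \<xi> * f x)"
    by (simp add: fourier_L1_def mult_ac flip: integral_mult_right_zero)
  have S: "(LINT \<xi>|lborel. ?h (\<xi>, x) * g \<xi> * f x) = f x * fourier_L1 g x" for x
  proof -
    have "(LINT \<xi>|lborel. ?h (\<xi>, x) * g \<xi> * f x) = (LINT \<xi>|lborel. f x * (exp (- (\<i> * 2 * pi * (x \<bullet> \<xi>))) * g \<xi>))"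
      by (simp add: mult_ac inner_commute)
    then show ?thesis by (simp only: integral_mult_right_zero fourier_L1_def)
  qed
  show ?thesis using F1 F by (simp only: S)
qed

section \<open>Convolution with a bounded integrable kernel\<close>

text \<open>
  A bounded integrable kernel is also square integrable. Its convolution with a function in
  \<open>L\<^sup>2\<close> is therefore given by a convergent integral at every point, not only almost everywhere,
  and depends linearly on that function without exceptional null sets.
\<close>

locale integrable_kernel =
  fixes k :: "'a::euclidean_space \<Rightarrow> real" and M :: real
  assumes kernel_integrable: "integrable lborel k"
    and kernel_nonneg: "\<And>x. 0 \<le> k x"
    and kernel_bounded: "\<And>x. k x \<le> M"
begin

lemma kernel_measurable [measurable]: "k \<in> borel_measurable borel"
  using kernel_integrable by auto

abbreviation conv :: "('a \<Rightarrow> complex) \<Rightarrow> 'a \<Rightarrow> complex" where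
  "conv \<equiv> Defs.convolution (\<lambda>x. complex_of_real (k x))"

lemma conv_measurable [measurable]:
  assumes [measurable]: "u \<in> borel_measurable borel"
  shows "conv u \<in> borel_measurable borel"
  unfolding Defs.convolution_def[abs_def] by measurable

lemma kernel_L2: "(\<lambda>y. complex_of_real (k (x - y))) \<in> L2_space"
proof (rule L2_spaceI)
  show "integrable lborel (\<lambda>y. (cmod (complex_of_real (k (x - y))))\<^sup>2)"
  proof (rule Bochner_Integration.integrable_bound)
    show "integrable lborel (\<lambda>y. M * k (x - y))"
      using integrable_lborel_reflect[OF kernel_integrable] by simp
    show "AE y in lborel. norm ((cmod (complex_of_real (k (x - y))))\<^sup>2) \<le> norm (M * k (x - y))"
    proof (rule AE_I2)
      fix y
      have "k (x - y) * k (x - y) \<le> M * k (x - y)"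
        using kernel_nonneg[of "x - y"] kernel_bounded[of "x - y"] by (intro mult_right_mono)
      then show "norm ((cmod (complex_of_real (k (x - y))))\<^sup>2) \<le> norm (M * k (x - y))"
        by (simp add: power2_eq_square)
    qed
  qed simp
qed simp

lemma conv_integrable:
  assumes u: "u \<in> L2_space"
  shows "integrable lborel (\<lambda>y. complex_of_real (k (x - y)) * u y)"
  using L2_inner_integrable[OF u kernel_L2[of x]] by (simp add: mult.commute)

lemma conv_diff:
  assumes "u \<in> L2_space" "v \<in> L2_space"
  shows "conv (\<lambda>y. u y - v y) x = conv u x - conv v x"
  using conv_integrable[OF assms(1), of x] conv_integrable[OF assms(2), of x]
  by (simp add: Defs.convolution_def algebra_simps)

lemma nn_integral_kernel: "(\<integral>\<^sup>+y. ennreal (k y) \<partial>lborel) = ennreal (LINT y|lborel. k y)"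
  using kernel_nonneg by (intro nn_integral_eq_integral kernel_integrable) auto

text \<open>
  Young's inequality: splitting \<open>k = sqrt k \<sqdot> sqrt k\<close>, the Cauchy-Schwarz inequality gives
  \<open>|k * u|\<^sup>2 \<le> (\<integral> k) \<sqdot> (k * |u|\<^sup>2)\<close> pointwise, which Tonelli's theorem integrates.
\<close>

lemma conv_L2_bound:
  assumes u: "u \<in> L2_space"
  shows "conv u \<in> L2_space \<and> L2_norm (conv u) \<le> (LINT y|lborel. k y) * L2_norm u"
proof -
  note [measurable] = L2_space_measurable[OF u]
  define I where "I = (LINT y|lborel. k y)"
  have I: "0 \<le> I" unfolding I_def using kernel_nonneg by (intro integral_nonneg_AE) auto
  have pt: "ennreal ((cmod (conv u x))\<^sup>2) \<le> ennreal I * (\<integral>\<^sup>+y. ennreal (k (x - y)) * ennreal ((cmod (u y))\<^sup>2) \<partial>lborel)" for x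
  proof -
    have "ennreal (cmod (conv u x)) \<le> (\<integral>\<^sup>+y. ennreal (cmod (complex_of_real (k (x - y)) * u y)) \<partial>lborel)"
      unfolding Defs.convolution_def by (intro integral_norm_bound_ennreal conv_integrable u)
    also have "\<dots> = (\<integral>\<^sup>+y. ennreal (sqrt (k (x - y))) * ennreal (sqrt (k (x - y)) * cmod (u y)) \<partial>lborel)"
      using kernel_nonneg by (intro nn_integral_cong) (simp add: norm_mult flip: ennreal_mult mult.assoc)
    finally have "(ennreal (cmod (conv u x)))\<^sup>2 \<le> \<dots>\<^sup>2" by (rule power_mono) simp
    also have "\<dots> \<le> (\<integral>\<^sup>+y. (ennreal (sqrt (k (x - y))))\<^sup>2 \<partial>lborel) * (\<integral>\<^sup>+y. (ennreal (sqrt (k (x - y)) * cmod (u y)))\<^sup>2 \<partial>lborel)"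
      by (rule Cauchy_Schwarz_nn_integral) auto
    also have "(\<integral>\<^sup>+y. (ennreal (sqrt (k (x - y))))\<^sup>2 \<partial>lborel) = ennreal I"
      using kernel_nonneg nn_integral_lborel_reflect[of "\<lambda>y. ennreal (k y)" x]
      by (simp add: ennreal_power nn_integral_kernel I_def)
    also have "(\<integral>\<^sup>+y. (ennreal (sqrt (k (x - y)) * cmod (u y)))\<^sup>2 \<partial>lborel)
        = (\<integral>\<^sup>+y. ennreal (k (x - y)) * ennreal ((cmod (u y))\<^sup>2) \<partial>lborel)"
      using kernel_nonneg by (intro nn_integral_cong) (simp add: ennreal_power power_mult_distrib flip: ennreal_mult)
    finally show ?thesis by (simp add: ennreal_power)
  qed
  have "(\<integral>\<^sup>+x. ennreal ((cmod (conv u x))\<^sup>2) \<partial>lborel)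
      \<le> (\<integral>\<^sup>+x. ennreal I * (\<integral>\<^sup>+y. ennreal (k (x - y)) * ennreal ((cmod (u y))\<^sup>2) \<partial>lborel) \<partial>lborel)"
    by (intro nn_integral_mono pt)
  also have "\<dots> = ennreal I * (\<integral>\<^sup>+x. \<integral>\<^sup>+y. ennreal (k (x - y)) * ennreal ((cmod (u y))\<^sup>2) \<partial>lborel \<partial>lborel)"
    by (rule nn_integral_cmult) measurable
  also have "(\<integral>\<^sup>+x. \<integral>\<^sup>+y. ennreal (k (x - y)) * ennreal ((cmod (u y))\<^sup>2) \<partial>lborel \<partial>lborel)
      = (\<integral>\<^sup>+y. \<integral>\<^sup>+x. ennreal (k (x - y)) * ennreal ((cmod (u y))\<^sup>2) \<partial>lborel \<partial>lborel)"
    by (rule lborel_pair.Fubini'[symmetric]) measurable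
  also have "\<dots> = (\<integral>\<^sup>+y. ennreal I * ennreal ((cmod (u y))\<^sup>2) \<partial>lborel)"
    using nn_integral_lborel_translate[of "\<lambda>y. ennreal (k y)"]
    by (intro nn_integral_cong) (simp add: nn_integral_multc nn_integral_kernel I_def)
  also have "\<dots> = ennreal I * ennreal ((L2_norm u)\<^sup>2)"
    using nn_integral_eq_integral[OF L2_space_integrable[OF u]]
    by (simp add: nn_integral_cmult L2_norm_square)
  also have "ennreal I * \<dots> = ennreal ((I * L2_norm u)\<^sup>2)"
    using I by (simp add: power_mult_distrib power2_eq_square ennreal_mult mult_ac)
  finally have le: "(\<integral>\<^sup>+x. ennreal ((cmod (conv u x))\<^sup>2) \<partial>lborel) \<le> ennreal ((I * L2_norm u)\<^sup>2)" .
  have int: "integrable lborel (\<lambda>x. (cmod (conv u x))\<^sup>2)"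
    using le by (intro integrableI_nonneg) (auto intro: le_less_trans[OF _ ennreal_less_top])
  have "(L2_norm (conv u))\<^sup>2 \<le> (I * L2_norm u)\<^sup>2"
    using le nn_integral_eq_integral[OF int] by (simp add: L2_norm_square)
  then have "L2_norm (conv u) \<le> I * L2_norm u"
    by (rule power2_le_imp_le) (use I in auto)
  moreover have "conv u \<in> L2_space" by (rule L2_spaceI[OF _ int]) simp
  ultimately show ?thesis by (simp add: I_def)
qed

lemmas conv_L2 = conv_L2_bound[THEN conjunct1] and young_L2 = conv_L2_bound[THEN conjunct2]

lemma conv_pair_integrable:
  assumes u: "u \<in> L1_space"
  shows "integrable (lborel \<Otimes>\<^sub>M lborel) (\<lambda>(y, x). exp (- (\<i> * 2 * pi * (\<xi> \<bullet> x))) * (complex_of_real (k (x - y)) * u y))"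
proof (rule lborel_pair.Fubini_integrable)
  note [measurable] = L1_space_measurable[OF u]
  have k': "integrable lborel (\<lambda>x. k (x - y))" for y
    by (rule integrable_lborel_translate[OF kernel_integrable])
  show "(\<lambda>(y, x). exp (- (\<i> * 2 * pi * (\<xi> \<bullet> x))) * (complex_of_real (k (x - y)) * u y)) \<in> borel_measurable (lborel \<Otimes>\<^sub>M lborel)"
    by measurable
  have "(\<lambda>y. LINT x|lborel. norm (case (y, x) of (y, x) \<Rightarrow> exp (- (\<i> * 2 * pi * (\<xi> \<bullet> x))) * (complex_of_real (k (x - y)) * u y)))
     = (\<lambda>y. (LINT x|lborel. k x) * cmod (u y))"
    using kernel_nonneg integral_lborel_translate[of k]
    by (auto simp: norm_mult fun_eq_iff)
  then show "integrable lborel (\<lambda>y. LINT x|lborel. norm (case (y, x) of (y, x) \<Rightarrow> exp (- (\<i> * 2 * pi * (\<xi> \<bullet> x))) * (complex_of_real (k (x - y)) * u y)))"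
    using u by (simp add: L1_space_def)
  show "AE y in lborel. integrable lborel (\<lambda>x. case (y, x) of (y, x) \<Rightarrow> exp (- (\<i> * 2 * pi * (\<xi> \<bullet> x))) * (complex_of_real (k (x - y)) * u y))"
  proof (rule AE_I2)
    fix y
    have "integrable lborel (\<lambda>x. complex_of_real (k (x - y)) * u y)" using k' by simp
    then show "integrable lborel (\<lambda>x. case (y, x) of (y, x) \<Rightarrow> exp (- (\<i> * 2 * pi * (\<xi> \<bullet> x))) * (complex_of_real (k (x - y)) * u y))"
      by (rule Bochner_Integration.integrable_bound) (auto simp: norm_mult)
  qed
qed

lemma conv_L1:
  assumes u: "u \<in> L1_space"
  shows "conv u \<in> L1_space"
  using lborel_pair.integrable_snd[OF conv_pair_integrable[OF u, of 0]]
  by (simp add: L1_space_def Defs.convolution_def[abs_def])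

lemma fourier_conv_L1:
  assumes u: "u \<in> L1_space"
  shows "fourier_L1 (conv u) \<xi> = fourier_L1 (\<lambda>x. complex_of_real (k x)) \<xi> * fourier_L1 u \<xi>"
proof -
  note [measurable] = L1_space_measurable[OF u]
  let ?e = "\<lambda>x. exp (- (\<i> * 2 * pi * (\<xi> \<bullet> x)))"
  have "fourier_L1 (conv u) \<xi> = (LINT x|lborel. LINT y|lborel. ?e x * (complex_of_real (k (x - y)) * u y))"
    by (simp add: fourier_L1_def Defs.convolution_def)
  also have "\<dots> = (LINT y|lborel. LINT x|lborel. ?e x * (complex_of_real (k (x - y)) * u y))"
    by (rule lborel_pair.Fubini_integral[OF conv_pair_integrable[OF u]])
  also have "\<dots> = (LINT y|lborel. (?e y * u y) * (LINT x|lborel. ?e (x - y) * complex_of_real (k (x - y))))"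
  proof (intro Bochner_Integration.integral_cong refl)
    fix y
    have E: "?e x = ?e y * ?e (x - y)" for x
      unfolding exp_add[symmetric] by (simp add: inner_diff_right algebra_simps)
    have "(LINT x|lborel. ?e x * (complex_of_real (k (x - y)) * u y))
      = (LINT x|lborel. (?e y * u y) * (?e (x - y) * complex_of_real (k (x - y))))"
      by (intro Bochner_Integration.integral_cong refl, subst E) (simp only: mult_ac)
    then show "(LINT x|lborel. ?e x * (complex_of_real (k (x - y)) * u y))
      = (?e y * u y) * (LINT x|lborel. ?e (x - y) * complex_of_real (k (x - y)))"
      by (simp only: integral_mult_right_zero)
  qed
  also have "\<dots> = (LINT y|lborel. (?e y * u y) * fourier_L1 (\<lambda>x. complex_of_real (k x)) \<xi>)"
    using integral_lborel_translate[of "\<lambda>x. ?e x * complex_of_real (k x)"]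
    by (simp add: fourier_L1_def)
  also have "\<dots> = fourier_L1 (\<lambda>x. complex_of_real (k x)) \<xi> * fourier_L1 u \<xi>"
    by (simp only: integral_mult_left_zero fourier_L1_def mult.commute)
  finally show ?thesis .
qed

end

section \<open>The heat kernel as an approximate identity\<close>

lemma gauss_L1: "0 < \<delta> \<Longrightarrow> (\<lambda>x. complex_of_real (gauss \<delta> x)) \<in> L1_space"
  by (simp add: L1_space_def integrable_gauss)

lemma integral_heat_kernel:
  assumes d: "0 < \<delta>"
  shows "integrable lborel (heat_kernel \<delta> :: 'a::euclidean_space \<Rightarrow> real)"
    and "(LINT x|lborel. heat_kernel \<delta> (x::'a)) = 1"
proof -
  have i: "integrable lborel (gauss (1/\<delta>) :: 'a \<Rightarrow> real)" using d by (intro integrable_gauss) simp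
  then show "integrable lborel (heat_kernel \<delta> :: 'a \<Rightarrow> real)"
    unfolding heat_kernel_def[abs_def] by simp
  have "complex_of_real (LINT x|lborel. gauss (1/\<delta>) (x::'a)) = fourier_L1 (\<lambda>x. complex_of_real (gauss (1/\<delta>) x)) (0::'a)"
    by (simp add: fourier_L1_def)
  also have "\<dots> = complex_of_real (\<delta> ^ DIM('a))"
    using d by (subst fourier_gauss) (simp_all add: heat_kernel_def gauss_def power_one_over)
  finally have "(LINT x|lborel. gauss (1/\<delta>) (x::'a)) = \<delta> ^ DIM('a)" by (simp only: of_real_eq_iff)
  then show "(LINT x|lborel. heat_kernel \<delta> (x::'a)) = 1"
    using d by (simp add: heat_kernel_def)
qed

lemma integrable_kernel_heat:
  assumes "0 < \<delta>"
  shows "integrable_kernel (heat_kernel \<delta> :: 'a::euclidean_space \<Rightarrow> real) (1 / \<delta> ^ DIM('a))"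
  by unfold_locales
     (use assms in \<open>auto intro: integral_heat_kernel heat_kernel_bound less_imp_le heat_kernel_pos\<close>)

abbreviation heat :: "real \<Rightarrow> ('a::euclidean_space \<Rightarrow> complex) \<Rightarrow> 'a \<Rightarrow> complex" where
  "heat \<delta> \<equiv> Defs.convolution (\<lambda>x. complex_of_real (heat_kernel \<delta> x))"

lemma
  assumes d: "0 < \<delta>" and u: "u \<in> L2_space"
  shows heat_L2: "heat \<delta> u \<in> L2_space" and heat_contraction: "L2_norm (heat \<delta> u) \<le> L2_norm u"
  using integrable_kernel.conv_L2[OF integrable_kernel_heat[OF d] u]
    integrable_kernel.young_L2[OF integrable_kernel_heat[OF d] u]
  by (simp_all add: integral_heat_kernel[OF d])

text \<open>
  Inversion with a Gaussian damping factor. It is the multiplication formula for \<open>f\<close> and a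
  modulated Gaussian, whose transform is a translated heat kernel.
\<close>

lemma fourier_gauss_regularization:
  fixes f :: "'a::euclidean_space \<Rightarrow> complex"
  assumes d: "0 < \<delta>" and f: "f \<in> L1_space"
  shows "fourier_L1 (\<lambda>\<xi>. fourier_L1 f \<xi> * complex_of_real (gauss \<delta> \<xi>)) (- x) = heat \<delta> f x"
proof -
  let ?g = "\<lambda>\<xi>. exp (- (\<i> * 2 * pi * ((- x) \<bullet> \<xi>))) * complex_of_real (gauss \<delta> \<xi>)"
  have g: "?g \<in> L1_space" unfolding L1_space_def using integrable_gauss_char[OF d, of "-x"] by simp
  have Fg: "fourier_L1 ?g y = heat_kernel \<delta> (x - y)" for y
  proof -
    have "fourier_L1 ?g y = fourier_L1 (\<lambda>\<xi>. complex_of_real (gauss \<delta> \<xi>)) (y - x)"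
      unfolding fourier_L1_def mult.assoc[symmetric] exp_add[symmetric]
      by (intro Bochner_Integration.integral_cong refl)
         (simp add: inner_diff_left algebra_simps)
    then show ?thesis
      using fourier_gauss[OF d, of "y - x"] heat_kernel_minus[of \<delta> "x - y"] by simp
  qed
  have "fourier_L1 (\<lambda>\<xi>. fourier_L1 f \<xi> * complex_of_real (gauss \<delta> \<xi>)) (- x) = (LINT \<xi>|lborel. fourier_L1 f \<xi> * ?g \<xi>)"
    by (subst fourier_L1_def) (simp only: mult_ac)
  also have "\<dots> = (LINT y|lborel. f y * fourier_L1 ?g y)"
    by (rule fourier_multiplication_formula[OF f g])
  also have "\<dots> = heat \<delta> f x"
    by (simp only: Fg Defs.convolution_def, simp only: mult.commute)
  finally show ?thesis .
qed

definition shrink :: "nat \<Rightarrow> real" where "shrink n = 1 / real (Suc n)"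

lemma shrink_pos [simp]: "0 < shrink n" by (simp add: shrink_def)
lemma shrink_tendsto: "shrink \<longlonglongrightarrow> 0"
  unfolding shrink_def[abs_def] by (rule lim_1_over_n[THEN LIMSEQ_Suc])

text \<open>After rescaling, the averaging measure is fixed and only the argument of \<open>g\<close> depends on \<open>\<delta>\<close>.\<close>

lemma heat_substitution:
  fixes g :: "'a::euclidean_space \<Rightarrow> complex"
  assumes d: "0 < \<delta>" and [measurable]: "g \<in> borel_measurable borel"
  shows "heat \<delta> g x = (LINT z|lborel. complex_of_real (gauss 1 z) * g (x + \<delta> *\<^sub>R z))"
proof -
  have "heat \<delta> g x = (LINT y|density (distr lborel borel (\<lambda>z. x + \<delta> *\<^sub>R z)) (\<lambda>_. \<bar>\<delta>\<bar>^DIM('a)). complex_of_real (heat_kernel \<delta> (x - y)) * g y)"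
    unfolding Defs.convolution_def using lborel_affine[of \<delta> x] d by simp
  also have "\<dots> = (LINT z|lborel. \<delta> ^ DIM('a) *\<^sub>R (complex_of_real (heat_kernel \<delta> (\<delta> *\<^sub>R z)) * g (x + \<delta> *\<^sub>R z)))"
    using d heat_kernel_minus[of \<delta> "\<delta> *\<^sub>R _"]
    by (subst integral_density) (auto simp: integral_distr simp flip: heat_kernel_minus[of \<delta> "- (\<delta> *\<^sub>R _)"])
  also have "\<dots> = (LINT z|lborel. complex_of_real (gauss 1 z) * g (x + \<delta> *\<^sub>R z))"
  proof (intro Bochner_Integration.integral_cong refl)
    fix z :: 'a
    have "gauss (1/\<delta>) (\<delta> *\<^sub>R z) = gauss 1 z" using d by (simp add: gauss_def)
    then show "\<delta> ^ DIM('a) *\<^sub>R (complex_of_real (heat_kernel \<delta> (\<delta> *\<^sub>R z)) * g (x + \<delta> *\<^sub>R z))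
      = complex_of_real (gauss 1 z) * g (x + \<delta> *\<^sub>R z)"
      using d by (simp add: heat_kernel_def scaleR_conv_of_real)
  qed
  finally show ?thesis .
qed

lemma integral_gauss_1: "(LINT z|lborel. gauss 1 (z::'a::euclidean_space)) = 1"
  using integral_heat_kernel(2)[of 1, where 'a='a] by (simp add: heat_kernel_def)

lemma heat_tendsto_pointwise:
  fixes g :: "'a::euclidean_space \<Rightarrow> complex"
  assumes c: "continuous_on UNIV g" and b: "\<And>x. cmod (g x) \<le> M"
  shows "(\<lambda>n. heat (shrink n) g x) \<longlonglongrightarrow> g x"
proof -
  have [measurable]: "g \<in> borel_measurable borel" by (rule borel_measurable_continuous_onI[OF c])
  have "(\<lambda>n. LINT z|lborel. complex_of_real (gauss 1 z) * g (x + shrink n *\<^sub>R z)) \<longlonglongrightarrow> (LINT z|lborel. complex_of_real (gauss 1 (z::'a)) * g x)"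
  proof (rule integral_dominated_convergence[where w="\<lambda>z. M * gauss 1 z"])
    show "integrable lborel (\<lambda>z::'a. M * gauss 1 z)" using integrable_gauss[of 1, where 'a='a] by simp
    show "AE z in lborel. (\<lambda>n. complex_of_real (gauss 1 z) * g (x + shrink n *\<^sub>R z)) \<longlonglongrightarrow> complex_of_real (gauss 1 z) * g x"
    proof (rule AE_I2)
      fix z :: 'a
      have "(\<lambda>n. x + shrink n *\<^sub>R z) \<longlonglongrightarrow> x + 0 *\<^sub>R z" by (intro tendsto_intros shrink_tendsto)
      then have "(\<lambda>n. g (x + shrink n *\<^sub>R z)) \<longlonglongrightarrow> g (x + 0 *\<^sub>R z)"
        using c by (intro isCont_tendsto_compose[where g=g]) (auto simp: continuous_on_eq_continuous_at)
      then show "(\<lambda>n. complex_of_real (gauss 1 z) * g (x + shrink n *\<^sub>R z)) \<longlonglongrightarrow> complex_of_real (gauss 1 z) * g x"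
        by (intro tendsto_intros) simp
    qed
    show "AE z in lborel. norm (complex_of_real (gauss 1 z) * g (x + shrink n *\<^sub>R z)) \<le> M * gauss 1 z" for n
      using b gauss_pos[where 'a='a] by (intro AE_I2) (auto simp: norm_mult mult.commute abs_of_pos intro!: mult_right_mono less_imp_le)
  qed auto
  moreover have "(LINT z|lborel. complex_of_real (gauss 1 (z::'a)) * g x) = g x"
    by (simp only: integral_mult_left_zero integral_complex_of_real integral_gauss_1) simp
  ultimately show ?thesis by (simp add: heat_substitution integral_gauss_1)
qed

lemma heat_bound:
  fixes g :: "'a::euclidean_space \<Rightarrow> complex"
  assumes d: "0 < \<delta>" and [measurable]: "g \<in> borel_measurable borel" and b: "\<And>x. cmod (g x) \<le> M"
  shows "cmod (heat \<delta> g x) \<le> M"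
proof -
  have i: "integrable lborel (\<lambda>z. complex_of_real (gauss 1 z) * g (x + \<delta> *\<^sub>R z))"
  proof (rule Bochner_Integration.integrable_bound)
    show "integrable lborel (\<lambda>z::'a. M * gauss 1 z)" using integrable_gauss[of 1, where 'a='a] by simp
    show "AE z in lborel. norm (complex_of_real (gauss 1 z) * g (x + \<delta> *\<^sub>R z)) \<le> norm (M * gauss 1 z)"
      using b gauss_pos[where 'a='a] by (intro AE_I2)
        (auto simp: norm_mult abs_mult mult.commute abs_of_pos intro!: mult_right_mono less_imp_le order_trans[OF b abs_ge_self])
  qed simp
  have "cmod (heat \<delta> g x) \<le> (LINT z|lborel. cmod (complex_of_real (gauss 1 z) * g (x + \<delta> *\<^sub>R z)))"
    unfolding heat_substitution[OF d assms(2)] by (rule integral_norm_bound)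
  also have "\<dots> \<le> (LINT z|lborel. M * gauss 1 (z::'a))"
    using integrable_norm[OF i] integrable_gauss[of 1, where 'a='a] b gauss_pos[where 'a='a]
    by (intro integral_mono) (auto simp: norm_mult mult.commute abs_of_pos intro!: mult_right_mono less_imp_le)
  also have "\<dots> = M" by (simp add: integral_gauss_1)
  finally show ?thesis .
qed

text \<open>
  Since the heat operator is a contraction, \<open>\<parallel>K g - g\<parallel>\<^sup>2 \<le> 2 \<parallel>g\<parallel>\<^sup>2 - 2 Re \<langle>K g, g\<rangle>\<close>, so it
  suffices that \<open>\<langle>K g, g\<rangle>\<close> tends to \<open>\<parallel>g\<parallel>\<^sup>2\<close>. The integrable function \<open>g\<close> provides the domination for that.
\<close>

lemma heat_tendsto_compact_support:
  fixes g :: "'a::euclidean_space \<Rightarrow> complex"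
  assumes c: "continuous_on UNIV g" and b: "\<And>x. cmod (g x) \<le> M" and s: "\<And>x. norm x > r \<Longrightarrow> g x = 0"
  shows "L2_tendsto (\<lambda>n. heat (shrink n) g) g"
proof -
  have [measurable]: "g \<in> borel_measurable borel" by (rule borel_measurable_continuous_onI[OF c])
  have g: "g \<in> L2_space" "g \<in> L1_space" by (rule L2_space_bounded_support[OF _ b s]; simp)+
  have H: "heat (shrink n) g \<in> L2_space" for n by (rule heat_L2[OF shrink_pos g(1)])
  note [measurable] = L2_space_measurable[OF H]
  have B: "cmod (heat (shrink n) g x) \<le> M" for n x
    by (rule heat_bound[OF shrink_pos _ b]) simp
  have "(\<lambda>n. L2_inner (heat (shrink n) g) g) \<longlonglongrightarrow> L2_inner g g"
    unfolding L2_inner_def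
  proof (rule integral_dominated_convergence[where w="\<lambda>x. M * cmod (g x)"])
    show "integrable lborel (\<lambda>x. M * cmod (g x))" using g(2) by (simp add: L1_space_def)
    show "AE x in lborel. (\<lambda>n. heat (shrink n) g x * cnj (g x)) \<longlonglongrightarrow> g x * cnj (g x)"
      by (intro AE_I2 tendsto_intros heat_tendsto_pointwise[OF c b])
    show "AE x in lborel. norm (heat (shrink n) g x * cnj (g x)) \<le> M * cmod (g x)" for n
      using B by (intro AE_I2) (auto simp: norm_mult intro!: mult_right_mono)
  qed auto
  from tendsto_Re[OF this]
  have L: "(\<lambda>n. 2 * (L2_norm g)\<^sup>2 - 2 * Re (L2_inner (heat (shrink n) g) g)) \<longlonglongrightarrow> 2 * (L2_norm g)\<^sup>2 - 2 * (L2_norm g)\<^sup>2"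
    by (intro tendsto_intros) (simp add: L2_inner_self)
  have "(\<lambda>n. (L2_norm (\<lambda>x. heat (shrink n) g x - g x))\<^sup>2) \<longlonglongrightarrow> 0"
  proof (rule Lim_null_comparison[OF always_eventually, rule_format])
    show "(\<lambda>n. 2 * (L2_norm g)\<^sup>2 - 2 * Re (L2_inner (heat (shrink n) g) g)) \<longlonglongrightarrow> 0" using L by simp
    fix n
    have "(L2_norm (heat (shrink n) g))\<^sup>2 \<le> (L2_norm g)\<^sup>2"
      by (intro power_mono heat_contraction g shrink_pos) simp
    then have "(L2_norm (\<lambda>x. heat (shrink n) g x - g x))\<^sup>2 \<le> 2 * (L2_norm g)\<^sup>2 - 2 * Re (L2_inner (heat (shrink n) g) g)"
      by (simp add: L2_norm_square_diff[OF H g(1)])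
    then show "norm ((L2_norm (\<lambda>x. heat (shrink n) g x - g x))\<^sup>2) \<le> 2 * (L2_norm g)\<^sup>2 - 2 * Re (L2_inner (heat (shrink n) g) g)"
      by simp
  qed
  then show ?thesis using H g by (simp add: L2_tendsto_def L2_norm_square)
qed

text \<open>Contractivity extends the convergence from a dense subspace to all of \<open>L\<^sup>2\<close>.\<close>

theorem heat_tendsto_L2:
  assumes u: "u \<in> L2_space"
  shows "L2_tendsto (\<lambda>n. heat (shrink n) u) u"
  unfolding L2_tendsto_iff
proof (intro conjI allI u heat_L2 shrink_pos LIMSEQ_I)
  fix e :: real assume e: "e > 0"
  then have e3: "e/3 > 0" by simp
  obtain g r M where c: "continuous_on UNIV g" and b: "\<forall>x. cmod (g x) \<le> M" and s: "\<forall>x. norm x > r \<longrightarrow> g x = 0"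
    and ug: "L2_norm (\<lambda>x. u x - g x) < e/3"
    by (rule compactly_supported_continuous_dense[OF u e3])
  have lim: "L2_tendsto (\<lambda>n. heat (shrink n) g) g"
    by (rule heat_tendsto_compact_support[OF c b[rule_format] s[rule_format]])
  then have g: "g \<in> L2_space" by (simp add: L2_tendsto_iff)
  from lim e have "\<forall>\<^sub>F n in sequentially. L2_norm (\<lambda>x. heat (shrink n) g x - g x) < e/3"
    by (intro order_tendstoD(2)) (auto simp: L2_tendsto_iff)
  then obtain N where N: "\<And>n. n \<ge> N \<Longrightarrow> L2_norm (\<lambda>x. heat (shrink n) g x - g x) < e/3"
    by (auto simp: eventually_sequentially)
  show "\<exists>N. \<forall>n\<ge>N. norm (L2_norm (\<lambda>x. heat (shrink n) u x - u x) - 0) < e"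
  proof (intro exI allI impI)
    fix n assume "n \<ge> N"
    let ?H = "heat (shrink n)"
    note HL = heat_L2[OF shrink_pos[of n] u] heat_L2[OF shrink_pos[of n] g]
    have D: "?H (\<lambda>x. u x - g x) = (\<lambda>x. ?H u x - ?H g x)"
      by (rule ext, rule integrable_kernel.conv_diff[OF integrable_kernel_heat[OF shrink_pos] u g])
    have "L2_norm (\<lambda>x. ?H u x - ?H g x) \<le> L2_norm (\<lambda>x. u x - g x)"
      using heat_contraction[OF shrink_pos[of n] L2_space_diff[OF u g]] unfolding D .
    moreover have "L2_norm (\<lambda>x. ?H u x - u x) \<le> L2_norm (\<lambda>x. ?H u x - ?H g x) + L2_norm (\<lambda>x. ?H g x - u x)"
      by (rule L2_norm_triangle_diff[OF HL u])
    moreover have "L2_norm (\<lambda>x. ?H g x - u x) \<le> L2_norm (\<lambda>x. ?H g x - g x) + L2_norm (\<lambda>x. g x - u x)"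
      by (rule L2_norm_triangle_diff[OF HL(2) g u])
    ultimately have "L2_norm (\<lambda>x. ?H u x - u x) < e"
      using N[OF \<open>n \<ge> N\<close>] ug L2_norm_minus_commute[of g u] by simp
    then show "norm (L2_norm (\<lambda>x. ?H u x - u x) - 0) < e" by simp
  qed
qed

section \<open>The Plancherel theorem\<close>

lemma fourier_regularized_L1_L2:
  assumes d: "0 < \<delta>" and f: "f \<in> L1_space"
  shows "(\<lambda>\<xi>. fourier_L1 f \<xi> * complex_of_real (gauss \<delta> \<xi>)) \<in> L1_space"
    and "(\<lambda>\<xi>. fourier_L1 f \<xi> * complex_of_real (gauss \<delta> \<xi>)) \<in> L2_space"
proof -
  note [measurable] = borel_measurable_fourier_L1[OF L1_space_measurable[OF f]]
  define B where "B = (LINT x|lborel. cmod (f x))"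
  have b: "cmod (fourier_L1 f \<xi> * complex_of_real (gauss \<delta> \<xi>)) \<le> B * cmod (complex_of_real (gauss \<delta> \<xi>))" for \<xi>
    unfolding norm_mult B_def by (intro mult_right_mono fourier_L1_bound f) simp
  show "(\<lambda>\<xi>. fourier_L1 f \<xi> * complex_of_real (gauss \<delta> \<xi>)) \<in> L2_space"
    by (rule L2_space_dominated[OF gauss_L2[OF d]]) (use b in auto)
  have "integrable lborel (\<lambda>\<xi>. B * cmod (complex_of_real (gauss \<delta> \<xi>)))"
    using integrable_norm[OF gauss_L1[OF d, unfolded L1_space_def mem_Collect_eq]] by (rule integrable_mult_right)
  then show "(\<lambda>\<xi>. fourier_L1 f \<xi> * complex_of_real (gauss \<delta> \<xi>)) \<in> L1_space"
    unfolding L1_space_def mem_Collect_eq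
    by (rule Bochner_Integration.integrable_bound)
       (use b in \<open>auto intro!: AE_I2 order_trans[OF _ abs_ge_self]\<close>)
qed

text \<open>
  The multiplication formula is applied to \<open>cnj f\<close>, whose transform is a reflected conjugate of
  that of \<open>f\<close>; this is why the damped transform \<open>h\<close> enters with reflected argument.
\<close>

lemma fourier_gauss_energy:
  assumes d: "0 < \<delta>" and f: "f \<in> L1_space"
  shows "integrable lborel (\<lambda>\<xi>. (cmod (fourier_L1 f \<xi>))\<^sup>2 * gauss \<delta> \<xi>)"
    and "(LINT \<xi>|lborel. complex_of_real ((cmod (fourier_L1 f \<xi>))\<^sup>2 * gauss \<delta> \<xi>)) = L2_inner (heat \<delta> f) f"
proof -
  note [measurable] = L1_space_measurable[OF f] borel_measurable_fourier_L1[OF L1_space_measurable[OF f]]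
  define h where "h = (\<lambda>\<xi>. fourier_L1 f \<xi> * complex_of_real (gauss \<delta> \<xi>))"
  have h: "h \<in> L1_space" unfolding h_def by (rule fourier_regularized_L1_L2[OF d f])
  have [measurable]: "h \<in> borel_measurable borel" using h by measurable
  have h': "(\<lambda>\<xi>. h (- \<xi>)) \<in> L1_space" using integrable_lborel_reflect[of h 0] h by (simp add: L1_space_def)
  have cf: "(\<lambda>x. cnj (f x)) \<in> L1_space" using f by (simp add: L1_space_def)
  have pt: "fourier_L1 (\<lambda>x. cnj (f x)) \<xi> * h (- \<xi>) = (\<lambda>\<xi>. complex_of_real ((cmod (fourier_L1 f \<xi>))\<^sup>2 * gauss \<delta> \<xi>)) (0 - \<xi>)" for \<xi>
  proof -
    have "complex_of_real ((cmod z)\<^sup>2 * r) = cnj z * (z * complex_of_real r)" for z r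
      by (simp only: of_real_mult complex_norm_square mult_ac)
    then show ?thesis by (simp only: fourier_L1_cnj h_def diff_0 gauss_minus)
  qed
  have Fh: "fourier_L1 (\<lambda>\<xi>. h (- \<xi>)) x = heat \<delta> f x" for x
    using fourier_gauss_regularization[OF d f, of x] by (subst fourier_L1_minus) (simp_all add: h_def)
  show "integrable lborel (\<lambda>\<xi>. (cmod (fourier_L1 f \<xi>))\<^sup>2 * gauss \<delta> \<xi>)"
  proof (rule Bochner_Integration.integrable_bound)
    show "integrable lborel (\<lambda>\<xi>. (LINT x|lborel. cmod (f x)) * cmod (h \<xi>))"
      using h by (simp add: L1_space_def)
    show "AE \<xi> in lborel. norm ((cmod (fourier_L1 f \<xi>))\<^sup>2 * gauss \<delta> \<xi>) \<le> norm ((LINT x|lborel. cmod (f x)) * cmod (h \<xi>))"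
    proof (rule AE_I2)
      fix \<xi>
      have "cmod (fourier_L1 f \<xi>) * cmod (h \<xi>) \<le> (LINT x|lborel. cmod (f x)) * cmod (h \<xi>)"
        by (intro mult_right_mono fourier_L1_bound f) simp
      then show "norm ((cmod (fourier_L1 f \<xi>))\<^sup>2 * gauss \<delta> \<xi>) \<le> norm ((LINT x|lborel. cmod (f x)) * cmod (h \<xi>))"
        by (simp add: h_def norm_mult power2_eq_square abs_mult mult_ac)
    qed
  qed simp
  have "(LINT \<xi>|lborel. complex_of_real ((cmod (fourier_L1 f \<xi>))\<^sup>2 * gauss \<delta> \<xi>))
      = (LINT \<xi>|lborel. fourier_L1 (\<lambda>x. cnj (f x)) \<xi> * h (- \<xi>))"
    unfolding pt by (rule integral_lborel_reflect[symmetric]) measurable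
  also have "\<dots> = (LINT x|lborel. cnj (f x) * heat \<delta> f x)"
    using fourier_multiplication_formula[OF cf h'] by (simp only: Fh)
  also have "\<dots> = L2_inner (heat \<delta> f) f"
    by (simp add: L2_inner_def mult.commute)
  finally show "(LINT \<xi>|lborel. complex_of_real ((cmod (fourier_L1 f \<xi>))\<^sup>2 * gauss \<delta> \<xi>)) = L2_inner (heat \<delta> f) f" .
qed

text \<open>
  As \<open>\<delta>\<close> tends to 0, the left-hand side of \<open>fourier_gauss_energy\<close> increases to \<open>\<parallel>F f\<parallel>\<^sup>2\<close> by
  monotone convergence, which also yields that this is finite, and the right-hand side tends
  to \<open>\<parallel>f\<parallel>\<^sup>2\<close>.
\<close>

theorem plancherel_L1_L2:
  assumes f1: "f \<in> L1_space" and f2: "f \<in> L2_space"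
  shows "fourier_L1 f \<in> L2_space" and "L2_norm (fourier_L1 f) = L2_norm f"
proof -
  note [measurable] = borel_measurable_fourier_L1[OF L1_space_measurable[OF f1]]
  let ?s = "\<lambda>n \<xi>. (cmod (fourier_L1 f \<xi>))\<^sup>2 * gauss (shrink n) \<xi>"
  have "(\<lambda>n. L2_inner (heat (shrink n) f) f) \<longlonglongrightarrow> L2_inner f f"
    by (rule L2_tendsto_inner[OF heat_tendsto_L2[OF f2]]) (simp add: L2_tendsto_iff f2 L2_norm_def)
  from tendsto_Re[OF this] have "(\<lambda>n. Re (L2_inner (heat (shrink n) f) f)) \<longlonglongrightarrow> (L2_norm f)\<^sup>2"
    by (simp add: L2_inner_self)
  moreover have "Re (L2_inner (heat (shrink n) f) f) = (LINT \<xi>|lborel. ?s n \<xi>)" for n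
    unfolding fourier_gauss_energy(2)[OF shrink_pos f1, symmetric] integral_complex_of_real by simp
  ultimately have lim: "(\<lambda>n. LINT \<xi>|lborel. ?s n \<xi>) \<longlonglongrightarrow> (L2_norm f)\<^sup>2" by simp
  have mono: "AE \<xi> in lborel. mono (\<lambda>n. ?s n \<xi>)"
  proof (intro AE_I2 monoI)
    fix \<xi> :: 'a and m n :: nat assume "m \<le> n"
    then have "shrink n \<le> shrink m" by (simp add: shrink_def frac_le)
    then have "(shrink n * norm \<xi>)\<^sup>2 \<le> (shrink m * norm \<xi>)\<^sup>2"
      using less_imp_le[OF shrink_pos[of n]] by (intro power_mono mult_right_mono) auto
    then show "?s m \<xi> \<le> ?s n \<xi>" by (intro mult_left_mono) (auto simp: gauss_def)
  qed
  have pt: "AE \<xi> in lborel. (\<lambda>n. ?s n \<xi>) \<longlonglongrightarrow> (cmod (fourier_L1 f \<xi>))\<^sup>2"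
  proof (rule AE_I2)
    fix \<xi> :: 'a
    have "(\<lambda>n. ?s n \<xi>) \<longlonglongrightarrow> (cmod (fourier_L1 f \<xi>))\<^sup>2 * exp (- pi * (0 * norm \<xi>)\<^sup>2)"
      unfolding gauss_def by (intro tendsto_intros shrink_tendsto)
    then show "(\<lambda>n. ?s n \<xi>) \<longlonglongrightarrow> (cmod (fourier_L1 f \<xi>))\<^sup>2" by simp
  qed
  have "has_bochner_integral lborel (\<lambda>\<xi>. (cmod (fourier_L1 f \<xi>))\<^sup>2) ((L2_norm f)\<^sup>2)"
    by (rule has_bochner_integral_monotone_convergence[OF fourier_gauss_energy(1)[OF shrink_pos f1] mono pt lim]) simp
  then have "integrable lborel (\<lambda>\<xi>. (cmod (fourier_L1 f \<xi>))\<^sup>2)" "(LINT \<xi>|lborel. (cmod (fourier_L1 f \<xi>))\<^sup>2) = (L2_norm f)\<^sup>2"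
    by (auto simp: has_bochner_integral_iff)
  then show "fourier_L1 f \<in> L2_space" "L2_norm (fourier_L1 f) = L2_norm f"
    by (auto intro: L2_spaceI simp: L2_norm_def)
qed

lemma has_fourier_L2:
  assumes "has_fourier u v"
  shows "u \<in> L2_space" "v \<in> L2_space"
  using assms by (auto simp: has_fourier_def L2_tendsto_def)

lemma has_fourier_diff:
  assumes "has_fourier u v" "has_fourier u' v'"
  shows "has_fourier (\<lambda>x. u x - u' x) (\<lambda>\<xi>. v \<xi> - v' \<xi>)"
proof -
  obtain f f' where f: "\<And>n. f n \<in> L1_space" "L2_tendsto f u" "L2_tendsto (\<lambda>n. fourier_L1 (f n)) v"
    and f': "\<And>n. f' n \<in> L1_space" "L2_tendsto f' u'" "L2_tendsto (\<lambda>n. fourier_L1 (f' n)) v'"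
    using assms unfolding has_fourier_def by blast
  have "fourier_L1 (\<lambda>x. f n x - f' n x) = (\<lambda>\<xi>. fourier_L1 (f n) \<xi> - fourier_L1 (f' n) \<xi>)" for n
    by (intro ext fourier_L1_diff f f')
  moreover have "(\<lambda>x. f n x - f' n x) \<in> L1_space" for n
    using f(1)[of n] f'(1)[of n] by (simp add: L1_space_def)
  ultimately show ?thesis
    unfolding has_fourier_def
    using L2_tendsto_diff[OF f(2) f'(2)] L2_tendsto_diff[OF f(3) f'(3)]
    by (intro exI[of _ "\<lambda>n x. f n x - f' n x"]) simp
qed

lemma has_fourier_cmult:
  assumes "has_fourier u v"
  shows "has_fourier (\<lambda>x. c * u x) (\<lambda>\<xi>. c * v \<xi>)"
proof -
  obtain f where f: "\<And>n. f n \<in> L1_space" "L2_tendsto f u" "L2_tendsto (\<lambda>n. fourier_L1 (f n)) v"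
    using assms unfolding has_fourier_def by blast
  have F: "fourier_L1 (\<lambda>x. c * f n x) = (\<lambda>\<xi>. c * fourier_L1 (f n) \<xi>)" for n
    by (simp add: fourier_L1_def fun_eq_iff mult.left_commute)
  have T: "L2_tendsto (\<lambda>n x. c * g n x) (\<lambda>x. c * w x)" if "L2_tendsto g w" for g w
  proof -
    have "(\<lambda>n. cmod c * L2_norm (\<lambda>x. g n x - w x)) \<longlonglongrightarrow> cmod c * 0"
      using that by (intro tendsto_intros) (simp add: L2_tendsto_iff)
    then have "(\<lambda>n. L2_norm (\<lambda>x. c * g n x - c * w x)) \<longlonglongrightarrow> 0"
      by (simp add: L2_norm_cmult flip: right_diff_distrib)
    with that show ?thesis by (simp add: L2_tendsto_iff L2_space_cmult)
  qed
  have "(\<lambda>x. c * f n x) \<in> L1_space" for n using f(1)[of n] by (simp add: L1_space_def)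
  then show ?thesis
    unfolding has_fourier_def using T[OF f(2)] T[OF f(3)]
    by (intro exI[of _ "\<lambda>n x. c * f n x"]) (simp add: F)
qed

lemma has_fourier_norm:
  assumes "has_fourier u v"
  shows "L2_norm v = L2_norm u"
proof -
  obtain f where f: "\<And>n. f n \<in> L1_space" "L2_tendsto f u" "L2_tendsto (\<lambda>n. fourier_L1 (f n)) v"
    using assms unfolding has_fourier_def by blast
  have "L2_norm (fourier_L1 (f n)) = L2_norm (f n)" for n
    using f by (intro plancherel_L1_L2) (auto simp: L2_tendsto_iff)
  then show ?thesis
    using LIMSEQ_unique[OF L2_tendsto_norm[OF f(3)]] L2_tendsto_norm[OF f(2)] by simp
qed

lemma has_fourier_unique:
  assumes "has_fourier u v" "has_fourier u v'"
  shows "AE \<xi> in lborel. v \<xi> = v' \<xi>"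
proof -
  have "L2_norm (\<lambda>\<xi>. v \<xi> - v' \<xi>) = 0"
    using has_fourier_norm[OF has_fourier_diff[OF assms]] by (simp add: L2_norm_def)
  from L2_norm_eq_0_imp_AE[OF L2_space_diff this] show ?thesis using assms has_fourier_L2 by auto
qed

lemma has_fourier_injective:
  assumes "has_fourier u v" "has_fourier u' v'" and eq: "AE \<xi> in lborel. v \<xi> = v' \<xi>"
  shows "AE x in lborel. u x = u' x"
proof -
  note L = has_fourier_L2[OF assms(1)] has_fourier_L2[OF assms(2)]
  have "L2_norm (\<lambda>\<xi>. v \<xi> - v' \<xi>) = L2_norm (\<lambda>\<xi>::'a. 0)"
    by (rule L2_norm_cong_AE) (use L eq in \<open>auto intro!: borel_measurable_diff\<close>)
  then have "L2_norm (\<lambda>x. u x - u' x) = 0"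
    using has_fourier_norm[OF has_fourier_diff[OF assms(1,2)]] by (simp add: L2_norm_def)
  from L2_norm_eq_0_imp_AE[OF L2_space_diff this] show ?thesis using L by auto
qed

text \<open>Polarization: the norms of \<open>u - u'\<close> and of \<open>\<i> u - u'\<close> determine the inner product.\<close>

theorem parseval:
  assumes "has_fourier u v" "has_fourier u' v'"
  shows "L2_inner v v' = L2_inner u u'"
proof -
  note L = has_fourier_L2[OF assms(1)] has_fourier_L2[OF assms(2)]
  have re: "Re (L2_inner p p') = ((L2_norm p)\<^sup>2 + (L2_norm p')\<^sup>2 - (L2_norm (\<lambda>x. p x - p' x))\<^sup>2) / 2"
    if "p \<in> L2_space" "p' \<in> L2_space" for p p' :: "'a \<Rightarrow> complex"
    using L2_norm_square_diff[OF that] by simp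
  have Re: "Re (L2_inner q q') = Re (L2_inner p p')" if "has_fourier p q" "has_fourier p' q'" for p p' q q' :: "'a \<Rightarrow> complex"
    using that has_fourier_L2[OF that(1)] has_fourier_L2[OF that(2)]
    by (simp add: re has_fourier_norm[OF that(1)] has_fourier_norm[OF that(2)] has_fourier_norm[OF has_fourier_diff[OF that]])
  have im: "Im (L2_inner p p') = - Re (L2_inner (\<lambda>x. \<i> * p x) p')" for p p' :: "'a \<Rightarrow> complex"
    by (simp add: L2_inner_def mult.assoc)
  show ?thesis
    using Re[OF assms] Re[OF has_fourier_cmult[OF assms(1), of \<i>] assms(2)]
    by (intro complex_eqI) (simp_all add: im)
qed

lemma L2_tendsto_Cauchy:
  assumes f: "L2_tendsto f u" and e: "0 < e"
  shows "\<exists>N. \<forall>m\<ge>N. \<forall>n\<ge>N. L2_norm (\<lambda>x. f m x - f n x) < e"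
proof -
  have "\<forall>\<^sub>F n in sequentially. L2_norm (\<lambda>x. f n x - u x) < e/2"
    using f e by (intro order_tendstoD(2)) (auto simp: L2_tendsto_iff)
  then obtain N where N: "\<And>n. n \<ge> N \<Longrightarrow> L2_norm (\<lambda>x. f n x - u x) < e/2"
    by (auto simp: eventually_sequentially)
  have "L2_norm (\<lambda>x. f m x - f n x) < e" if "m \<ge> N" "n \<ge> N" for m n
    using L2_norm_triangle_diff[of "f m" u "f n"] f N[OF that(1)] N[OF that(2)]
      L2_norm_minus_commute[of u "f n"] by (simp add: L2_tendsto_iff)
  then show ?thesis by blast
qed

lemma fourier_L1_isometry_diff:
  assumes f: "\<And>n. f n \<in> L1_space" "\<And>n. f n \<in> L2_space"
  shows "L2_norm (\<lambda>\<xi>. fourier_L1 (f m) \<xi> - fourier_L1 (f n) \<xi>) = L2_norm (\<lambda>x. f m x - f n x)"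
proof -
  have "(\<lambda>\<xi>. fourier_L1 (f m) \<xi> - fourier_L1 (f n) \<xi>) = fourier_L1 (\<lambda>x. f m x - f n x)"
    by (intro ext fourier_L1_diff[symmetric] f)
  moreover have "(\<lambda>x. f m x - f n x) \<in> L1_space" using f(1)[of m] f(1)[of n] by (simp add: L1_space_def)
  ultimately show ?thesis
    using plancherel_L1_L2(2)[OF _ L2_space_diff[OF f(2) f(2)]] by simp
qed

lemma has_fourier_exists:
  assumes u: "u \<in> L2_space"
  shows "\<exists>v. has_fourier u v"
proof -
  let ?f = "truncation u"
  note T = truncation_tendsto_L2[OF u]
  have f: "?f n \<in> L1_space" "?f n \<in> L2_space" for n
    using T truncation_L1[OF u] by (auto simp: L2_tendsto_iff)
  have "\<exists>N. \<forall>m\<ge>N. \<forall>n\<ge>N. L2_norm (\<lambda>x. fourier_L1 (?f m) x - fourier_L1 (?f n) x) < e" if "0 < e" for e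
    unfolding fourier_L1_isometry_diff[of ?f, OF f] by (rule L2_tendsto_Cauchy[OF T that])
  from L2_complete[OF plancherel_L1_L2(1)[OF f] this]
  obtain v where "L2_tendsto (\<lambda>n. fourier_L1 (?f n)) v" by blast
  with T f show ?thesis unfolding has_fourier_def by blast
qed

text \<open>
  By \<open>fourier_gauss_regularization\<close>, \<open>K * g\<close> is the transform of a reflected damped transform
  of \<open>g\<close>. Truncations \<open>g\<close> of \<open>v\<close> bring \<open>K * g\<close> arbitrarily close to \<open>v\<close>.
\<close>

lemma fourier_L1_range_dense:
  assumes v: "v \<in> L2_space" and e: "0 < e"
  obtains f where "f \<in> L1_space" "f \<in> L2_space" "L2_norm (\<lambda>\<xi>. fourier_L1 f \<xi> - v \<xi>) < e"
proof -
  have "\<forall>\<^sub>F n in sequentially. L2_norm (\<lambda>x. truncation v n x - v x) < e/2"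
    using truncation_tendsto_L2[OF v] e by (intro order_tendstoD(2)) (auto simp: L2_tendsto_iff)
  then obtain m where m: "L2_norm (\<lambda>x. truncation v m x - v x) < e/2" by (auto simp: eventually_sequentially)
  define g where "g = truncation v m"
  have g: "g \<in> L1_space" "g \<in> L2_space"
    using truncation_L1[OF v] truncation_tendsto_L2[OF v] by (auto simp: g_def L2_tendsto_iff)
  have "\<forall>\<^sub>F n in sequentially. L2_norm (\<lambda>x. heat (shrink n) g x - g x) < e/2"
    using heat_tendsto_L2[OF g(2)] e by (intro order_tendstoD(2)) (auto simp: L2_tendsto_iff)
  then obtain n where n: "L2_norm (\<lambda>x. heat (shrink n) g x - g x) < e/2" by (auto simp: eventually_sequentially)
  define h where "h = (\<lambda>\<xi>. fourier_L1 g \<xi> * complex_of_real (gauss (shrink n) \<xi>))"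
  have h: "h \<in> L1_space" "h \<in> L2_space"
    unfolding h_def by (rule fourier_regularized_L1_L2[OF shrink_pos g(1)])+
  note [measurable] = L2_space_measurable[OF h(2)]
  define f where "f = (\<lambda>x. h (- x))"
  have f1: "f \<in> L1_space" using h(1) integrable_lborel_reflect[of h 0] by (simp add: L1_space_def f_def)
  have f2: "f \<in> L2_space" unfolding f_def
    by (rule L2_spaceI) (use integrable_lborel_reflect[OF L2_space_integrable[OF h(2)], of 0] in auto)
  have F: "fourier_L1 f = heat (shrink n) g"
    unfolding f_def
    using fourier_gauss_regularization[OF shrink_pos g(1), of n, folded h_def]
    by (intro ext) (simp add: fourier_L1_minus)
  have "L2_norm (\<lambda>\<xi>. fourier_L1 f \<xi> - v \<xi>) \<le> L2_norm (\<lambda>x. heat (shrink n) g x - g x) + L2_norm (\<lambda>x. g x - v x)"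
    unfolding F by (rule L2_norm_triangle_diff[OF heat_L2[OF shrink_pos g(2)] g(2) v])
  also have "\<dots> < e" using m n by (simp add: g_def)
  finally show thesis using that f1 f2 by blast
qed

text \<open>
  Functions whose transforms approximate \<open>v\<close> form a Cauchy sequence by the isometry, and the
  limit has transform \<open>v\<close>.
\<close>

lemma has_fourier_surjective:
  assumes v: "v \<in> L2_space"
  shows "\<exists>u. has_fourier u v"
proof -
  have "\<exists>f. f \<in> L1_space \<and> f \<in> L2_space \<and> L2_norm (\<lambda>\<xi>. fourier_L1 f \<xi> - v \<xi>) < shrink n" for n
    using fourier_L1_range_dense[OF v shrink_pos[of n]] by blast
  then obtain f where f: "\<And>n. f n \<in> L1_space" "\<And>n. f n \<in> L2_space"
    and fv: "\<And>n. L2_norm (\<lambda>\<xi>. fourier_L1 (f n) \<xi> - v \<xi>) < shrink n" by metis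
  have T: "L2_tendsto (\<lambda>n. fourier_L1 (f n)) v"
    unfolding L2_tendsto_iff
  proof (intro conjI allI v plancherel_L1_L2 f)
    show "(\<lambda>n. L2_norm (\<lambda>\<xi>. fourier_L1 (f n) \<xi> - v \<xi>)) \<longlonglongrightarrow> 0"
      by (rule Lim_null_comparison[OF always_eventually shrink_tendsto]) (use fv in \<open>auto intro: less_imp_le\<close>)
  qed
  have "\<exists>N. \<forall>m\<ge>N. \<forall>n\<ge>N. L2_norm (\<lambda>x. f m x - f n x) < e" if "0 < e" for e
    unfolding fourier_L1_isometry_diff[of f, OF f, symmetric] by (rule L2_tendsto_Cauchy[OF T that])
  from L2_complete[OF f(2) this] obtain u where "L2_tendsto f u" by blast
  with T f show ?thesis unfolding has_fourier_def by blast
qed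

lemma has_fourier_fourier: "u \<in> L2_space \<Longrightarrow> has_fourier u (fourier u)"
  unfolding fourier_def by (rule someI_ex[OF has_fourier_exists])

lemma inverse_fourier_in_L2_iff: "inverse_fourier_in_L2 g \<longleftrightarrow> g \<in> L2_space"
  unfolding inverse_fourier_in_L2_def using has_fourier_L2 has_fourier_surjective by blast

text \<open>
  The identity for integrable functions passes to the limit: convolution is continuous on \<open>L\<^sup>2\<close>
  by Young's inequality, multiplication by the transform of \<open>k\<close> because that function is bounded.
\<close>

theorem (in integrable_kernel) has_fourier_conv:
  assumes uv: "has_fourier u v"
  shows "has_fourier (conv u) (\<lambda>\<xi>. fourier_L1 (\<lambda>x. complex_of_real (k x)) \<xi> * v \<xi>)"
proof -
  define m where "m = fourier_L1 (\<lambda>x. complex_of_real (k x))"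
  define I where "I = (LINT x|lborel. k x)"
  have kL1: "(\<lambda>x. complex_of_real (k x)) \<in> L1_space" using kernel_integrable by (simp add: L1_space_def)
  have [measurable]: "m \<in> borel_measurable borel" unfolding m_def by (intro borel_measurable_fourier_L1) simp
  have mb: "cmod (m \<xi>) \<le> I" for \<xi>
    using fourier_L1_bound[OF kL1, of \<xi>] kernel_nonneg by (simp add: m_def I_def)
  have I: "0 \<le> I" using mb[of 0] norm_ge_zero order_trans by blast
  obtain f where f: "\<And>n. f n \<in> L1_space" "L2_tendsto f u" "L2_tendsto (\<lambda>n. fourier_L1 (f n)) v"
    using uv unfolding has_fourier_def by blast
  have L: "u \<in> L2_space" "v \<in> L2_space" "\<And>n. f n \<in> L2_space" "\<And>n. fourier_L1 (f n) \<in> L2_space"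
    using f(2,3) by (auto simp: L2_tendsto_iff)
  have F: "fourier_L1 (conv (f n)) = (\<lambda>\<xi>. m \<xi> * fourier_L1 (f n) \<xi>)" for n
    unfolding m_def by (rule ext) (rule fourier_conv_L1[OF f(1)])
  have mult: "(\<lambda>\<xi>. m \<xi> * g \<xi>) \<in> L2_space" if "g \<in> L2_space" for g
  proof -
    note [measurable] = L2_space_measurable[OF that]
    show ?thesis
      by (rule L2_space_dominated[OF that, of _ I]) (use mb in \<open>auto simp: norm_mult intro!: mult_right_mono\<close>)
  qed
  have mult_norm: "L2_norm (\<lambda>\<xi>. m \<xi> * g \<xi>) \<le> I * L2_norm g" if "g \<in> L2_space" for g
  proof -
    have "L2_norm (\<lambda>\<xi>. m \<xi> * g \<xi>) \<le> L2_norm (\<lambda>\<xi>. complex_of_real I * g \<xi>)"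
      using mb I by (intro L2_norm_mono_AE mult L2_space_cmult that) (auto simp: norm_mult intro!: mult_right_mono)
    then show ?thesis using I by (simp add: L2_norm_cmult)
  qed
  have "L2_tendsto (\<lambda>n. conv (f n)) (conv u)"
    unfolding L2_tendsto_iff
  proof (intro conjI allI conv_L2 L)
    have "(\<lambda>n. I * L2_norm (\<lambda>x. f n x - u x)) \<longlonglongrightarrow> I * 0"
      using f(2) by (intro tendsto_intros) (simp add: L2_tendsto_iff)
    then have *: "(\<lambda>n. I * L2_norm (\<lambda>x. f n x - u x)) \<longlonglongrightarrow> 0" by simp
    show "(\<lambda>n. L2_norm (\<lambda>x. conv (f n) x - conv u x)) \<longlonglongrightarrow> 0"
    proof (rule Lim_null_comparison[OF always_eventually *], rule allI)
      fix n
      show "norm (L2_norm (\<lambda>x. conv (f n) x - conv u x)) \<le> I * L2_norm (\<lambda>x. f n x - u x)"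
        using young_L2[OF L2_space_diff[OF L(3)[of n] L(1)]]
        unfolding conv_diff[OF L(3)[of n] L(1), abs_def] I_def by simp
    qed
  qed
  moreover have "L2_tendsto (\<lambda>n. fourier_L1 (conv (f n))) (\<lambda>\<xi>. m \<xi> * v \<xi>)"
    unfolding L2_tendsto_iff F
  proof (intro conjI allI mult L)
    have "(\<lambda>n. I * L2_norm (\<lambda>x. fourier_L1 (f n) x - v x)) \<longlonglongrightarrow> I * 0"
      using f(3) by (intro tendsto_intros) (simp add: L2_tendsto_iff)
    then have *: "(\<lambda>n. I * L2_norm (\<lambda>x. fourier_L1 (f n) x - v x)) \<longlonglongrightarrow> 0" by simp
    show "(\<lambda>n. L2_norm (\<lambda>\<xi>. m \<xi> * fourier_L1 (f n) \<xi> - m \<xi> * v \<xi>)) \<longlonglongrightarrow> 0"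
    proof (rule Lim_null_comparison[OF always_eventually *], rule allI)
      fix n
      show "norm (L2_norm (\<lambda>\<xi>. m \<xi> * fourier_L1 (f n) \<xi> - m \<xi> * v \<xi>)) \<le> I * L2_norm (\<lambda>x. fourier_L1 (f n) x - v x)"
        using mult_norm[OF L2_space_diff[OF L(4)[of n] L(2)]] by (simp add: right_diff_distrib)
    qed
  qed
  ultimately show ?thesis
    unfolding has_fourier_def using conv_L1[OF f(1)]
    by (fold m_def, intro exI[of _ "\<lambda>n. conv (f n)"] conjI allI)
qed

section \<open>The transform of the Matern kernel\<close>

lemma has_bochner_integral_Gamma:
  assumes s: "0 < s"
  shows "has_bochner_integral lborel (\<lambda>t. indicator {0<..} t * t powr (s - 1) * exp (- t)) (Gamma (s::real))"
proof (rule has_bochner_integral_nn_integral)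
  have "indicator {0<..} t * t powr (s - 1) * exp (- t) = indicator {0..} t * t powr (s - 1) / exp t" for t :: real
    by (auto simp: indicator_def exp_minus field_simps)
  then show "(\<integral>\<^sup>+t. ennreal (indicator {0<..} t * t powr (s - 1) * exp (- t)) \<partial>lborel) = ennreal (Gamma s)"
    using Gamma_conv_nn_integral_real[OF s] by simp
qed (use s in \<open>auto intro: less_imp_le\<close>)

lemma has_bochner_integral_Gamma_scaled:
  fixes s w :: real
  assumes s: "0 < s" and w: "0 < w"
  shows "has_bochner_integral lborel (\<lambda>t. indicator {0<..} t * t powr (s - 1) * exp (- (w * t))) (Gamma s * w powr (- s))"
proof -
  let ?f = "\<lambda>t. indicator {0<..} t * t powr (s - 1) * exp (- t)"
  have "has_bochner_integral lborel (\<lambda>t. ?f (0 + w * t)) (Gamma s /\<^sub>R \<bar>w\<bar>)"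
    using has_bochner_integral_Gamma[OF s] w by (subst (asm) lborel_has_bochner_integral_real_affine_iff[where c=w and t=0]) auto
  then have "has_bochner_integral lborel (\<lambda>t. w powr (1 - s) * ?f (0 + w * t)) (w powr (1 - s) * (Gamma s /\<^sub>R \<bar>w\<bar>))"
    by (rule has_bochner_integral_mult_right)
  moreover have E: "w powr (1 - s) * ?f (0 + w * t) = indicator {0<..} t * t powr (s - 1) * exp (- (w * t))" for t
    using w by (auto simp: indicator_def zero_less_mult_iff powr_mult powr_diff field_simps)
  moreover have "w powr (1 - s) * (Gamma s /\<^sub>R \<bar>w\<bar>) = Gamma s * w powr (- s)"
    using w by (simp add: powr_diff powr_minus field_simps)
  ultimately show ?thesis by (simp only:)
qed

lemma gauss_inverse_sqrt:
  assumes "0 < t"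
  shows "gauss (1 / sqrt (4 * pi * t)) x = exp (- (norm x)\<^sup>2 / (4 * t))"
  using assms by (simp add: gauss_def power_mult_distrib power_divide)

text \<open>
  The integrand \<open>exp (- z cosh \<tau>) cosh (\<nu> \<tau>)\<close> is the even part of \<open>exp (- z cosh \<tau> + \<nu> \<tau>)\<close>, so the
  integral over the half line is half the integral of the latter over the whole line. There
  the substitution \<open>t = (z / 2) exp \<tau>\<close> gives \<open>z cosh \<tau> = t + z\<^sup>2 / (4 t)\<close> and \<open>exp (\<nu> \<tau>) = (2 t / z) powr \<nu>\<close>.
\<close>

lemma macdonald_substitution:
  fixes \<nu> z :: real
  assumes nu: "0 < \<nu>" and z: "0 < z"
  shows "macdonald \<nu> z = (2 / z) powr \<nu> / 2 *
    (LINT t|lborel. indicator {0<..} t * t powr (\<nu> - 1) * exp (- t) * exp (- z\<^sup>2 / (4 * t)))"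
proof -
  let ?h = "\<lambda>t. indicator {0<..} t * t powr (\<nu> - 1) * exp (- t) * exp (- z\<^sup>2 / (4 * t))"
  define F where "F = (\<lambda>\<tau>. exp (- z * cosh \<tau> + \<nu> * \<tau>))"
  define G where "G = (\<lambda>\<tau>. exp (- z * cosh \<tau>) * cosh (\<nu> * \<tau>))"
  have h: "integrable lborel ?h"
  proof (rule Bochner_Integration.integrable_bound)
    show "integrable lborel (\<lambda>t. indicator {0<..} t * t powr (\<nu> - 1) * exp (- t))"
      using has_bochner_integral_Gamma[OF nu] by (simp add: has_bochner_integral_iff)
    show "AE t in lborel. norm (?h t) \<le> norm (indicator {0<..} t * t powr (\<nu> - 1) * exp (- t))"
      by (intro AE_I2) (auto simp: indicator_def abs_mult intro!: mult_left_le)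
  qed simp
  \<comment> \<open>The change of variables is run from \<open>t\<close> to \<open>\<tau> = ln (2 t / z)\<close>: in the variable \<open>t\<close> the integrand
    is dominated by that of the Gamma integral, so integrability is known beforehand.\<close>
  have FG: "F (ln (2 * t / z)) * (1 / t) = (2 / z) powr \<nu> * ?h t" if t: "0 < t" for t
  proof -
    have "z * cosh (ln (2 * t / z)) = t + z\<^sup>2 / (4 * t)"
      using z t by (subst cosh_ln_real) (auto simp: field_simps power2_eq_square)
    then have "F (ln (2 * t / z)) = exp (- t) * exp (- z\<^sup>2 / (4 * t)) * (2 * t / z) powr \<nu>"
      using z t by (simp add: F_def powr_def mult.commute flip: exp_add)
    also have "(2 * t / z) powr \<nu> = (2 / z) powr \<nu> * t powr \<nu>"
      using z t powr_mult[of "2/z" t \<nu>] by simp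
    finally show ?thesis using t by (simp add: powr_diff)
  qed
  have ein: "einterval 0 \<infinity> = {0::real<..}" by (auto simp: einterval_def)
  have int: "set_integrable lborel (einterval 0 \<infinity>) (\<lambda>t. F (ln (2 * t / z)) * (1 / t))"
  proof -
    have "integrable lborel (\<lambda>t. (2 / z) powr \<nu> * ?h t)" using h by simp
    also have "(\<lambda>t. (2 / z) powr \<nu> * ?h t) = (\<lambda>t. indicator {0<..} t *\<^sub>R (F (ln (2 * t / z)) * (1 / t)))"
      using FG by (auto simp: fun_eq_iff indicator_def)
    finally show ?thesis by (simp add: set_integrable_def ein)
  qed
  have lim0: "((ereal \<circ> (\<lambda>t. ln (2 * t / z)) \<circ> real_of_ereal) \<longlongrightarrow> -\<infinity>) (at_right 0)"
  proof -
    have "LIM t at_right 0. ln (2 * t / z) :> at_bot"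
    proof (rule filterlim_compose[OF ln_at_0])
      have "((\<lambda>t. 2 * t / z) \<longlongrightarrow> 2 * 0 / z) (at_right 0)" using z by (intro tendsto_intros) auto
      then show "LIM t at_right 0. 2 * t / z :> at_right 0"
        using z by (auto simp: filterlim_at eventually_at_right_less intro!: eventually_mono[OF eventually_at_right_less])
    qed
    then show ?thesis by (simp add: zero_ereal_def ereal_tendsto_simps)
  qed
  have lim_top: "((ereal \<circ> (\<lambda>t. ln (2 * t / z)) \<circ> real_of_ereal) \<longlongrightarrow> \<infinity>) (at_left \<infinity>)"
  proof -
    have "LIM t at_top. ln (2 / z * t) :> at_top"
      using z by (intro filterlim_compose[OF ln_at_top] filterlim_tendsto_pos_mult_at_top[OF tendsto_const] filterlim_ident) auto
    then show ?thesis by (simp add: ereal_tendsto_simps)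
  qed
  have d: "((\<lambda>t. ln (2 * t / z)) has_real_derivative 1 / t) (at t)" "isCont (\<lambda>t. 1 / t) t" if "0 < ereal t" for t
    using z that by (auto intro!: continuous_intros derivative_eq_intros)
  have cF: "isCont F t" "0 \<le> F t" for t unfolding F_def by (auto intro!: continuous_intros)
  have S: "set_integrable lborel (einterval (-\<infinity>) \<infinity>) F"
     "(LBINT x=-\<infinity>..\<infinity>. F x) = (LBINT t=0..\<infinity>. F (ln (2 * t / z)) * (1 / t))"
    using interval_integral_substitution_nonneg[OF _ d(1) cF(1) d(2) cF(2) _ lim0 lim_top int] by auto
  have Fi: "integrable lborel F" using S(1) by (simp add: set_integrable_def)
  have "(LINT \<tau>|lborel. F \<tau>) = (LINT t|lborel. indicator {0<..} t *\<^sub>R (F (ln (2 * t / z)) * (1 / t)))"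
    using S(2) by (simp add: interval_lebesgue_integral_def set_lebesgue_integral_def ein)
  also have "\<dots> = (LINT t|lborel. (2 / z) powr \<nu> * ?h t)"
    using FG by (intro Bochner_Integration.integral_cong) (auto simp: indicator_def)
  finally have F: "(LINT \<tau>|lborel. F \<tau>) = (2 / z) powr \<nu> * (LINT t|lborel. ?h t)" by simp
  have G: "G \<tau> = (F \<tau> + F (0 + (-1) * \<tau>)) / 2" for \<tau>
    by (simp add: F_def G_def cosh_field_def[of "\<nu> * \<tau>"] exp_add exp_diff exp_minus field_simps)
  have Fi': "integrable lborel (\<lambda>\<tau>. F (0 + (-1) * \<tau>))"
    by (rule lborel_integrable_real_affine[OF Fi]) simp
  have "(LINT \<tau>|lborel. F (0 + (-1) * \<tau>)) = (LINT \<tau>|lborel. F \<tau>)"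
    using lborel_integral_real_affine[of "-1" F 0] by simp
  then have GF: "(LINT \<tau>|lborel. G \<tau>) = (LINT \<tau>|lborel. F \<tau>)" and Gi: "integrable lborel G"
    using Fi Fi' unfolding G by simp_all
  have "integrable lborel (\<lambda>\<tau>. indicator {0..} \<tau> *\<^sub>R G \<tau>)"
    using Gi by (intro integrable_mult_indicator) auto
  then have "has_bochner_integral lborel (\<lambda>\<tau>. indicator {0..} \<tau> *\<^sub>R G \<tau>) (macdonald \<nu> z)"
    by (simp add: has_bochner_integral_iff macdonald_def set_lebesgue_integral_def G_def)
  then have "has_bochner_integral lborel G (2 *\<^sub>R macdonald \<nu> z)"
    by (rule has_bochner_integral_even_function) (simp add: G_def)
  then have "2 * macdonald \<nu> z = (LINT \<tau>|lborel. G \<tau>)" by (simp add: has_bochner_integral_iff)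
  then show ?thesis by (simp add: GF F)
qed

abbreviation matern_unit :: "real \<Rightarrow> 'a::euclidean_space \<Rightarrow> real" where
  "matern_unit \<nu> \<equiv> matern \<nu> (sqrt (2 * \<nu>))"

text \<open>
  The factor \<open>|x| powr \<nu>\<close> in the definition cancels against the one produced by the
  substitution. At the origin the mixture is the Gamma integral itself, which matches the
  value 1 of the continuous extension.
\<close>

lemma matern_gauss_mixture:
  fixes x :: "'a::euclidean_space"
  assumes nu: "0 < \<nu>"
  shows "matern_unit \<nu> x = (1 / Gamma \<nu>) *
    (LINT t|lborel. indicator {0<..} t * t powr (\<nu> - 1) * exp (- t) * gauss (1 / sqrt (4 * pi * t)) x)"
proof -
  let ?g = "\<lambda>z t. indicator {0<..} t * t powr (\<nu> - 1) * exp (- t) * exp (- z\<^sup>2 / (4 * t))"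
  have G: "Gamma \<nu> > 0" using nu by simp
  have E: "indicator {0<..} t * t powr (\<nu> - 1) * exp (- t) * gauss (1 / sqrt (4 * pi * t)) x = ?g (norm x) t" for t
    by (cases "t > 0") (simp_all add: gauss_inverse_sqrt)
  have "(LINT t|lborel. indicator {0<..} t * t powr (\<nu> - 1) * exp (- t) * gauss (1 / sqrt (4 * pi * t)) x)
      = (LINT t|lborel. ?g (norm x) t)" by (simp only: E)
  moreover have "matern_unit \<nu> x = (1 / Gamma \<nu>) * (LINT t|lborel. ?g (norm x) t)"
  proof (cases "x = 0")
    case True
    then show ?thesis using has_bochner_integral_Gamma[OF nu] G by (simp add: matern_def has_bochner_integral_iff)
  next
    case False
    then have z: "norm x > 0" by simp
    have "2 powr (1 - \<nu>) * (norm x powr \<nu> * (2 / norm x) powr \<nu>) = 2"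
      using z by (simp add: powr_mult[symmetric] powr_add[symmetric])
    then have "2 powr (1 - \<nu>) * norm x powr \<nu> * macdonald \<nu> (norm x) = (LINT t|lborel. ?g (norm x) t)"
      unfolding macdonald_substitution[OF nu z] by (simp add: field_simps)
    moreover have "sqrt (2 * \<nu>) * norm x / sqrt (2 * \<nu>) = norm x" using nu by simp
    ultimately show ?thesis using False by (simp add: matern_def)
  qed
  ultimately show ?thesis by simp
qed


lemma sqrt_power_split:
  fixes t :: real
  assumes "0 < t"
  shows "sqrt (4 * pi * t) ^ n = (4 * pi) powr (real n / 2) * t powr (real n / 2)"
proof -
  have "sqrt (4 * pi * t) = (4 * pi * t) powr (1/2)"
    using assms by (intro powr_half_sqrt[symmetric]) simp
  then have "sqrt (4 * pi * t) ^ n = ((4 * pi * t) powr (1/2)) powr real n"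
    using assms by (simp add: powr_realpow)
  also have "\<dots> = (4 * pi) powr (real n / 2) * t powr (real n / 2)"
    using assms by (simp add: powr_powr powr_mult)
  finally show ?thesis .
qed

text \<open>
  Integrating out \<open>x\<close> first leaves a Gamma integral with parameter \<open>\<nu> + d / 2\<close>, because a Gaussian
  of variance proportional to \<open>t\<close> has mass proportional to \<open>t powr (d / 2)\<close>.
\<close>

lemma gauss_mixture_integrable:
  fixes \<xi> :: "'a::euclidean_space"
  assumes nu: "0 < \<nu>"
  shows "integrable (lborel \<Otimes>\<^sub>M lborel) (\<lambda>(t, x::'a). exp (- (\<i> * 2 * pi * (\<xi> \<bullet> x))) *
    complex_of_real (indicator {0<..} t * t powr (\<nu> - 1) * exp (- t) * gauss (1 / sqrt (4 * pi * t)) x))"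
    (is "integrable _ (\<lambda>(t, x). ?e x * complex_of_real (?h t * gauss (?d t) x))")
proof (rule lborel_pair.Fubini_integrable)
  let ?s = "\<nu> + real DIM('a) / 2"
  have d: "0 < ?d t" if "0 < t" for t :: real using that by simp
  have K: "(LINT x|lborel. norm (?e x * complex_of_real (?h t * gauss (?d t) x)))
      = (4 * pi) powr (real DIM('a) / 2) * (indicator {0<..} t * t powr (?s - 1) * exp (- t))" for t
  proof (cases "0 < t")
    case True
    have "(LINT x|lborel. norm (?e x * complex_of_real (?h t * gauss (?d t) x))) = ?h t * (LINT x|lborel. gauss (?d t) (x::'a))"
      using True by (simp add: norm_mult abs_mult less_imp_le[OF gauss_pos])
    also have "(LINT x|lborel. gauss (?d t) (x::'a)) = sqrt (4 * pi * t) ^ DIM('a)"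
      using integral_heat_kernel(2)[of "1 / ?d t", where 'a='a] True by (simp add: heat_kernel_def field_simps)
    also have "?h t * \<dots> = (4 * pi) powr (real DIM('a) / 2) * (exp (- t) * (t powr (\<nu> - 1) * t powr (real DIM('a) / 2)))"
      using True by (simp add: sqrt_power_split)
    also have "t powr (\<nu> - 1) * t powr (real DIM('a) / 2) = t powr (?s - 1)"
      by (simp add: powr_add[symmetric] algebra_simps)
    finally show ?thesis using True by simp
  next
    case False
    then show ?thesis by simp
  qed
  show "(\<lambda>(t, x). ?e x * complex_of_real (?h t * gauss (?d t) x)) \<in> borel_measurable (lborel \<Otimes>\<^sub>M lborel)"
    unfolding gauss_def by measurable
  have "integrable lborel (\<lambda>t. (4 * pi) powr (real DIM('a) / 2) * (indicator {0<..} t * t powr (?s - 1) * exp (- t)))"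
    using has_bochner_integral_Gamma[of ?s] nu by (simp add: has_bochner_integral_iff add_pos_nonneg)
  then show "integrable lborel (\<lambda>t. LINT x|lborel. norm (case (t, x) of (t, x) \<Rightarrow> ?e x * complex_of_real (?h t * gauss (?d t) x)))"
    by (simp only: K prod.case)
  show "AE t in lborel. integrable lborel (\<lambda>x. case (t, x) of (t, x) \<Rightarrow> ?e x * complex_of_real (?h t * gauss (?d t) x))"
  proof (rule AE_I2)
    fix t
    show "integrable lborel (\<lambda>x. case (t, x) of (t, x) \<Rightarrow> ?e x * complex_of_real (?h t * gauss (?d t) x))"
    proof (cases "0 < t")
      case True
      have "integrable lborel (\<lambda>x. complex_of_real (?h t) * (?e x * complex_of_real (gauss (?d t) x)))"
        by (intro integrable_mult_right integrable_gauss_char d True)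
      then show ?thesis by (simp add: mult_ac)
    qed simp
  qed
qed

lemma integrable_kernel_matern:
  assumes nu: "0 < \<nu>"
  shows "integrable_kernel (matern_unit \<nu> :: 'a::euclidean_space \<Rightarrow> real) 1"
proof
  let ?h = "\<lambda>t. indicator {0<..} t * t powr (\<nu> - 1) * exp (- t) :: real"
  have G: "Gamma \<nu> > 0" using nu by simp
  have hi: "integrable lborel ?h" "(LINT t|lborel. ?h t) = Gamma \<nu>"
    using has_bochner_integral_Gamma[OF nu] by (auto simp: has_bochner_integral_iff)
  have "integrable lborel (\<lambda>x::'a. LINT t|lborel. complex_of_real (?h t * gauss (1 / sqrt (4 * pi * t)) x))"
    using lborel_pair.integrable_snd[OF gauss_mixture_integrable[OF nu, of "0::'a"]] by simp
  then have "integrable lborel (\<lambda>x::'a. LINT t|lborel. ?h t * gauss (1 / sqrt (4 * pi * t)) x)"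
    unfolding integral_complex_of_real by (simp only: complex_of_real_integrable_eq)
  then show "integrable lborel (matern_unit \<nu> :: 'a \<Rightarrow> real)"
    by (simp add: matern_gauss_mixture[OF nu, abs_def])
  fix x :: 'a
  have "0 \<le> (LINT t|lborel. ?h t * gauss (1 / sqrt (4 * pi * t)) x)"
    by (intro integral_nonneg_AE AE_I2) (simp add: less_imp_le[OF gauss_pos])
  then show "0 \<le> matern_unit \<nu> x" using G by (simp add: matern_gauss_mixture[OF nu])
  have "(LINT t|lborel. ?h t * gauss (1 / sqrt (4 * pi * t)) x) \<le> (LINT t|lborel. ?h t)"
  proof (rule integral_mono)
    show "integrable lborel (\<lambda>t. ?h t * gauss (1 / sqrt (4 * pi * t)) x)"
      by (rule Bochner_Integration.integrable_bound[OF hi(1)])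
         (auto simp: gauss_def abs_mult intro!: AE_I2 mult_left_le)
    show "?h t * gauss (1 / sqrt (4 * pi * t)) x \<le> ?h t" for t
      by (intro mult_left_le gauss_le_1) simp
  qed (rule hi)
  then show "matern_unit \<nu> x \<le> 1" using G by (simp add: matern_gauss_mixture[OF nu] hi)
qed

text \<open>
  The transform of the Gaussian with parameter \<open>t\<close> is \<open>(4 \<pi> t) powr (d / 2) exp (- 4 \<pi>\<^sup>2 t |\<xi>|\<^sup>2)\<close>. Together
  with \<open>exp (-t)\<close> it makes the mixture a Gamma integral with rate \<open>1 + 4 \<pi>\<^sup>2 |\<xi>|\<^sup>2\<close>.
\<close>

theorem fourier_matern:
  fixes \<xi> :: "'a::euclidean_space"
  assumes nu: "0 < \<nu>"
  defines "s \<equiv> \<nu> + real DIM('a) / 2"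
  shows "fourier_L1 (\<lambda>x. complex_of_real (matern_unit \<nu> x)) \<xi>
    = complex_of_real ((4 * pi) powr (real DIM('a) / 2) * Gamma s / Gamma \<nu> * (1 + 4 * pi\<^sup>2 * (norm \<xi>)\<^sup>2) powr (- s))"
proof -
  let ?h = "\<lambda>t. indicator {0<..} t * t powr (\<nu> - 1) * exp (- t) :: real"
  let ?d = "\<lambda>t. 1 / sqrt (4 * pi * t)"
  let ?e = "\<lambda>x. exp (- (\<i> * 2 * pi * (\<xi> \<bullet> x)))"
  let ?w = "1 + 4 * pi\<^sup>2 * (norm \<xi>)\<^sup>2"
  have s: "0 < s" using nu by (simp add: s_def add_pos_nonneg)
  have w: "0 < ?w" by (simp add: add_pos_nonneg)
  have "fourier_L1 (\<lambda>x. complex_of_real (matern_unit \<nu> x)) \<xi>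
     = (LINT x|lborel. complex_of_real (1 / Gamma \<nu>) * (LINT t|lborel. ?e x * complex_of_real (?h t * gauss (?d t) x)))"
    unfolding fourier_L1_def
    by (simp only: matern_gauss_mixture[OF nu] of_real_mult[of "1 / Gamma \<nu>"] integral_complex_of_real[symmetric]
      integral_mult_right_zero mult.left_commute)
  also have "\<dots> = complex_of_real (1 / Gamma \<nu>) * (LINT x|lborel. LINT t|lborel. ?e x * complex_of_real (?h t * gauss (?d t) x))"
    by (rule integral_mult_right_zero)
  also have "(LINT x|lborel. LINT t|lborel. ?e x * complex_of_real (?h t * gauss (?d t) x))
      = (LINT t|lborel. LINT x|lborel. ?e x * complex_of_real (?h t * gauss (?d t) x))"
    by (rule lborel_pair.Fubini_integral[OF gauss_mixture_integrable[OF nu]])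
  also have "\<dots> = (LINT t|lborel. complex_of_real ((4 * pi) powr (real DIM('a) / 2) * (indicator {0<..} t * t powr (s - 1) * exp (- (?w * t)))))"
  proof (intro Bochner_Integration.integral_cong refl)
    fix t :: real
    show "(LINT x|lborel. ?e x * complex_of_real (?h t * gauss (?d t) x))
      = complex_of_real ((4 * pi) powr (real DIM('a) / 2) * (indicator {0<..} t * t powr (s - 1) * exp (- (?w * t))))"
    proof (cases "0 < t")
      case True
      have "(LINT x|lborel. ?e x * complex_of_real (?h t * gauss (?d t) x))
          = (LINT x|lborel. complex_of_real (?h t) * (?e x * complex_of_real (gauss (?d t) x)))"
        by (simp only: of_real_mult mult_ac)
      also have "\<dots> = complex_of_real (?h t) * fourier_L1 (\<lambda>x. complex_of_real (gauss (?d t) x)) \<xi>"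
        by (simp only: integral_mult_right_zero fourier_L1_def)
      also have "\<dots> = complex_of_real (?h t * heat_kernel (?d t) \<xi>)"
        using True by (simp add: fourier_gauss)
      also have "?h t * heat_kernel (?d t) \<xi> = (4 * pi) powr (real DIM('a) / 2) * (indicator {0<..} t * t powr (s - 1) * exp (- (?w * t)))"
      proof -
        have "?h t * heat_kernel (?d t) \<xi> = t powr (\<nu> - 1) * exp (- t) * (exp (- pi * (sqrt (4 * pi * t) * norm \<xi>)\<^sup>2) * sqrt (4 * pi * t) ^ DIM('a))"
          using True by (simp add: heat_kernel_def gauss_def power_one_over)
        also have "\<dots> = (4 * pi) powr (real DIM('a) / 2) * ((t powr (\<nu> - 1) * t powr (real DIM('a) / 2))
            * (exp (- t) * exp (- pi * (sqrt (4 * pi * t) * norm \<xi>)\<^sup>2)))"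
          using True by (simp add: sqrt_power_split)
        also have "t powr (\<nu> - 1) * t powr (real DIM('a) / 2) = t powr (s - 1)"
          by (simp add: s_def powr_add[symmetric] algebra_simps)
        also have "exp (- t) * exp (- pi * (sqrt (4 * pi * t) * norm \<xi>)\<^sup>2) = exp (- (?w * t))"
          using True by (simp add: power_mult_distrib power2_eq_square algebra_simps flip: exp_add)
        finally show ?thesis using True by simp
      qed
      finally show ?thesis .
    qed simp
  qed
  also have "\<dots> = complex_of_real ((4 * pi) powr (real DIM('a) / 2) * (Gamma s * ?w powr (- s)))"
    using has_bochner_integral_Gamma_scaled[OF s w] by (simp only: integral_complex_of_real) (simp add: has_bochner_integral_iff)
  finally show ?thesis by simp
qed

section \<open>The adjoint of the Sobolev embedding\<close>

abbreviation bessel_weight :: "real \<Rightarrow> 'a::euclidean_space \<Rightarrow> real" where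
  "bessel_weight r \<xi> \<equiv> (1 + 4 * pi\<^sup>2 * (norm \<xi>)\<^sup>2) powr r"

lemma bessel_base_pos: "0 < 1 + 4 * pi\<^sup>2 * (norm \<xi>)\<^sup>2"
  by (intro add_pos_nonneg) auto

lemma bessel_weight_pos: "0 < bessel_weight r \<xi>"
  using bessel_base_pos[of \<xi>] by simp

lemma bessel_weight_le_1: "r \<le> 0 \<Longrightarrow> bessel_weight r \<xi> \<le> 1"
  using powr_mono[of r 0 "1 + 4 * pi\<^sup>2 * (norm \<xi>)\<^sup>2"] bessel_base_pos[of \<xi>] by simp

lemma sobolev_space_iff:
  "u \<in> sobolev_space s \<longleftrightarrow> u \<in> L2_space \<and>
    (\<forall>r. 0 \<le> r \<and> r \<le> s \<longrightarrow> (\<lambda>\<xi>. complex_of_real (bessel_weight (r / 2) \<xi>) * fourier u \<xi>) \<in> L2_space)"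
  by (simp add: sobolev_space_def inverse_fourier_in_L2_iff)

lemma fourier_L2: "u \<in> L2_space \<Longrightarrow> fourier u \<in> L2_space"
  by (rule has_fourier_L2(2)[OF has_fourier_fourier])

text \<open>
  Distributing the weight evenly over both arguments exhibits the Sobolev inner product as an
  inner product of two functions that are known to be square integrable.
\<close>

lemma sobolev_inner_eq_L2_inner:
  "sobolev_inner s u v = L2_inner (\<lambda>\<xi>. complex_of_real (bessel_weight (s / 2) \<xi>) * fourier u \<xi>)
      (\<lambda>\<xi>. complex_of_real (bessel_weight (s / 2) \<xi>) * fourier v \<xi>)"
proof -
  have "complex_of_real (bessel_weight s \<xi>) = complex_of_real (bessel_weight (s/2) \<xi>) * complex_of_real (bessel_weight (s/2) \<xi>)" for \<xi> :: 'a
    by (simp flip: of_real_mult powr_add)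
  then show ?thesis by (simp add: sobolev_inner_def L2_inner_def mult_ac)
qed

lemma L2_inner_diff_right:
  assumes "u \<in> L2_space" "v \<in> L2_space" "w \<in> L2_space"
  shows "L2_inner u (\<lambda>x. v x - w x) = L2_inner u v - L2_inner u w"
  using L2_inner_integrable[OF assms(1,2)] L2_inner_integrable[OF assms(1,3)]
  by (simp add: L2_inner_def algebra_simps)

lemma L2_inner_diff_left:
  assumes "u \<in> L2_space" "v \<in> L2_space" "w \<in> L2_space"
  shows "L2_inner (\<lambda>x. v x - w x) u = L2_inner v u - L2_inner w u"
  using L2_inner_integrable[OF assms(2,1)] L2_inner_integrable[OF assms(3,1)]
  by (simp add: L2_inner_def algebra_simps)

text \<open>
  Testing with \<open>p\<close> and with \<open>q\<close> shows that the weighted transforms of \<open>p\<close> and \<open>q\<close> have distance 0;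
  the weight vanishes nowhere and the transform is injective.
\<close>

lemma sobolev_representative_unique:
  assumes s: "0 \<le> s" and p: "p \<in> sobolev_space s" and q: "q \<in> sobolev_space s"
    and eq: "\<And>x. x \<in> sobolev_space s \<Longrightarrow> sobolev_inner s x p = sobolev_inner s x q"
  shows "AE x in lborel. p x = q x"
proof -
  let ?P = "\<lambda>\<xi>. complex_of_real (bessel_weight (s / 2) \<xi>) * fourier p \<xi>"
  let ?Q = "\<lambda>\<xi>. complex_of_real (bessel_weight (s / 2) \<xi>) * fourier q \<xi>"
  have L: "?P \<in> L2_space" "?Q \<in> L2_space" "p \<in> L2_space" "q \<in> L2_space"
    using p q s by (auto simp: sobolev_space_iff)
  have "L2_inner (\<lambda>\<xi>. ?P \<xi> - ?Q \<xi>) (\<lambda>\<xi>. ?P \<xi> - ?Q \<xi>) = 0"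
    using eq[OF p] eq[OF q] unfolding sobolev_inner_eq_L2_inner
    by (simp add: L2_inner_diff_right[OF L2_space_diff[OF L(1,2)] L(1,2)] L2_inner_diff_left[OF L(1) L(1,2)] L2_inner_diff_left[OF L(2) L(1,2)])
  then have "L2_norm (\<lambda>\<xi>. ?P \<xi> - ?Q \<xi>) = 0" unfolding L2_inner_self by simp
  from L2_norm_eq_0_imp_AE[OF L2_space_diff[OF L(1,2)] this]
  have "AE \<xi> in lborel. fourier p \<xi> = fourier q \<xi>"
  proof eventually_elim
    case (elim \<xi>)
    then have "complex_of_real (bessel_weight (s / 2) \<xi>) * (fourier p \<xi> - fourier q \<xi>) = 0"
      by (simp only: right_diff_distrib)
    moreover have "bessel_weight (s / 2) \<xi> \<noteq> 0" using bessel_weight_pos[of \<xi> "s/2"] by linarith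
    ultimately show ?case by (simp del: powr_eq_0_iff)
  qed
  then show ?thesis
    by (rule has_fourier_injective[OF has_fourier_fourier[OF L(3)] has_fourier_fourier[OF L(4)]])
qed

text \<open>
  The weight \<open>w powr s\<close> of the inner product cancels the multiplier \<open>w powr (-s)\<close>, and Parseval's
  identity does the rest. Membership in the Sobolev space holds as \<open>w powr (r / 2 - s) \<le> 1\<close> for \<open>r \<le> s\<close>.
\<close>

lemma sobolev_adjoint_by_multiplier:
  fixes T :: "('a::euclidean_space \<Rightarrow> complex) \<Rightarrow> 'a \<Rightarrow> complex"
  assumes T: "\<And>u. u \<in> L2_space \<Longrightarrow> has_fourier (T u) (\<lambda>\<xi>. complex_of_real (bessel_weight (- s) \<xi>) * fourier u \<xi>)"
  shows "is_adjoint (sobolev_space s) (sobolev_inner s) L2_space L2_inner (sobolev_embedding s) T"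
  unfolding is_adjoint_def
proof (intro conjI ballI)
  fix u :: "'a \<Rightarrow> complex" assume u: "u \<in> L2_space"
  have Tu: "T u \<in> L2_space" using has_fourier_L2[OF T[OF u]] by simp
  have AE: "AE \<xi> in lborel. fourier (T u) \<xi> = complex_of_real (bessel_weight (- s) \<xi>) * fourier u \<xi>"
    by (rule has_fourier_unique[OF has_fourier_fourier[OF Tu] T[OF u]])
  note [measurable] = L2_space_measurable[OF fourier_L2[OF u]] L2_space_measurable[OF fourier_L2[OF Tu]]
  show "T u \<in> sobolev_space s"
    unfolding sobolev_space_iff
  proof (intro conjI allI impI Tu)
    fix r assume r: "0 \<le> r \<and> r \<le> s"
    show "(\<lambda>\<xi>. complex_of_real (bessel_weight (r / 2) \<xi>) * fourier (T u) \<xi>) \<in> L2_space"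
    proof (rule L2_space_dominated[OF fourier_L2[OF u], where C=1])
      show "AE \<xi> in lborel. cmod (complex_of_real (bessel_weight (r / 2) \<xi>) * fourier (T u) \<xi>) \<le> 1 * cmod (fourier u \<xi>)"
        using AE
      proof eventually_elim
        case (elim \<xi>)
        have "cmod (complex_of_real (bessel_weight (r / 2) \<xi>) * fourier (T u) \<xi>) = bessel_weight (r / 2 - s) \<xi> * cmod (fourier u \<xi>)"
          by (simp add: elim norm_mult flip: mult.assoc powr_add)
        also have "\<dots> \<le> 1 * cmod (fourier u \<xi>)"
          using r by (intro mult_right_mono bessel_weight_le_1) auto
        finally show ?case .
      qed
    qed measurable
  qed
  fix x :: "'a \<Rightarrow> complex" assume x: "x \<in> sobolev_space s"
  then have xL: "x \<in> L2_space" by (simp add: sobolev_space_iff)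
  note [measurable] = L2_space_measurable[OF fourier_L2[OF xL]]
  have "sobolev_inner s x (T u) = L2_inner (fourier x) (fourier u)"
    unfolding sobolev_inner_def L2_inner_def
  proof (rule integral_cong_AE)
    show "AE \<xi> in lborel. complex_of_real (bessel_weight s \<xi>) * fourier x \<xi> * cnj (fourier (T u) \<xi>) = fourier x \<xi> * cnj (fourier u \<xi>)"
      using AE
    proof eventually_elim
      case (elim \<xi>)
      have "bessel_weight s \<xi> * bessel_weight (- s) \<xi> = 1"
        using bessel_weight_pos[of \<xi> s] by (simp add: powr_add[symmetric] add_nonneg_eq_0_iff)
      then have "complex_of_real (bessel_weight s \<xi>) * complex_of_real (bessel_weight (- s) \<xi>) = 1"
        by (simp only: of_real_mult[symmetric] of_real_1)
      then have "(complex_of_real (bessel_weight s \<xi>) * complex_of_real (bessel_weight (- s) \<xi>)) * (fourier x \<xi> * cnj (fourier u \<xi>)) = fourier x \<xi> * cnj (fourier u \<xi>)"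
        by (simp only: mult_1)
      then show ?case by (simp only: elim complex_cnj_mult complex_cnj_complex_of_real mult_ac)
    qed
  qed measurable
  also have "\<dots> = L2_inner x u"
    by (rule parseval[OF has_fourier_fourier[OF xL] has_fourier_fourier[OF u]])
  finally show "L2_inner (sobolev_embedding s x) u = sobolev_inner s x (T u)"
    by (simp add: sobolev_embedding_def)
qed

lemma sobolev_adjoint_unique:
  assumes s: "0 \<le> s"
    and S: "is_adjoint (sobolev_space s) (sobolev_inner s) L2_space L2_inner (sobolev_embedding s) S"
    and T: "is_adjoint (sobolev_space s) (sobolev_inner s) L2_space L2_inner (sobolev_embedding s) T"
    and u: "u \<in> L2_space"
  shows "AE x in lborel. S u x = T u x"
proof (rule sobolev_representative_unique[OF s])
  show "S u \<in> sobolev_space s" "T u \<in> sobolev_space s" using S T u by (auto simp: is_adjoint_def)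
  fix x :: "'a \<Rightarrow> complex" assume "x \<in> sobolev_space s"
  then have "sobolev_inner s x (S u) = L2_inner (sobolev_embedding s x) u"
    "sobolev_inner s x (T u) = L2_inner (sobolev_embedding s x) u"
    using S T u unfolding is_adjoint_def by metis+
  then show "sobolev_inner s x (S u) = sobolev_inner s x (T u)" by simp
qed

text \<open>
  An adjoint exists, so the choice in \<open>sobolev_embedding_adjoint\<close> selects one, and by uniqueness
  it agrees almost everywhere with the rescaled Matern operator.
\<close>

theorem proposition3p2:
  fixes \<nu> :: real
  assumes "\<nu> > 0"
  shows "\<exists>c::real. c \<noteq> 0 \<and>
    (\<forall>u \<in> (L2_space :: (real ^ 'n \<Rightarrow> complex) set).
       AE x in lborel.
         matern_operator \<nu> (sqrt (2 * \<nu>)) u x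
           = complex_of_real c * sobolev_embedding_adjoint (\<nu> + real CARD('n) / 2) u x)"
proof -
  define s where "s = \<nu> + real CARD('n) / 2"
  define c where "c = (4 * pi) powr (real CARD('n) / 2) * Gamma s / Gamma \<nu>"
  have s: "0 < s" using assms by (simp add: s_def add_pos_nonneg)
  have "0 < Gamma s" "0 < Gamma \<nu>" using assms s by (auto intro: Gamma_real_pos)
  then have c: "c \<noteq> 0" by (simp add: c_def)
  interpret integrable_kernel "matern_unit \<nu> :: real ^ 'n \<Rightarrow> real" 1
    by (rule integrable_kernel_matern[OF assms])
  define T :: "(real ^ 'n \<Rightarrow> complex) \<Rightarrow> real ^ 'n \<Rightarrow> complex"
    where "T = (\<lambda>u x. complex_of_real (1 / c) * matern_operator \<nu> (sqrt (2 * \<nu>)) u x)"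
  let ?adj = "is_adjoint (sobolev_space s) (sobolev_inner s) L2_space L2_inner (sobolev_embedding s)"
  have T: "?adj T"
  proof (rule sobolev_adjoint_by_multiplier)
    fix u :: "real ^ 'n \<Rightarrow> complex" assume u: "u \<in> L2_space"
    have F: "fourier_L1 (\<lambda>x. complex_of_real (matern_unit \<nu> x)) \<xi> = complex_of_real (c * bessel_weight (- s) \<xi>)" for \<xi> :: "real ^ 'n"
      using fourier_matern[OF assms, of \<xi>] by (simp add: c_def s_def)
    have "has_fourier (T u) (\<lambda>\<xi>. complex_of_real (1 / c) * (complex_of_real (c * bessel_weight (- s) \<xi>) * fourier u \<xi>))"
      using has_fourier_cmult[OF has_fourier_conv[OF has_fourier_fourier[OF u]], of "complex_of_real (1 / c)"]
      unfolding T_def matern_operator_def F .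
    also have "(\<lambda>\<xi>. complex_of_real (1 / c) * (complex_of_real (c * bessel_weight (- s) \<xi>) * fourier u \<xi>))
        = (\<lambda>\<xi>. complex_of_real (bessel_weight (- s) \<xi>) * fourier u \<xi>)"
      using c by (simp add: fun_eq_iff)
    finally show "has_fourier (T u) (\<lambda>\<xi>. complex_of_real (bessel_weight (- s) \<xi>) * fourier u \<xi>)" .
  qed
  have S: "?adj (sobolev_embedding_adjoint s :: (real ^ 'n \<Rightarrow> complex) \<Rightarrow> _)"
    unfolding sobolev_embedding_adjoint_def by (rule someI[of ?adj, OF T])
  have "AE x in lborel. matern_operator \<nu> (sqrt (2 * \<nu>)) u x = complex_of_real c * sobolev_embedding_adjoint s u x"
    if u: "u \<in> L2_space" for u :: "real ^ 'n \<Rightarrow> complex"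
    using sobolev_adjoint_unique[OF less_imp_le[OF s] S T u]
  proof eventually_elim
    case (elim x)
    then show ?case using c by (simp add: T_def)
  qed
  then show ?thesis using c unfolding s_def by blast
qed

end
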